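(* For every $\emptyset\subseteq I\subseteq J\subseteq[n-1]^2$ and every $B\in\{0,\pm\}^I$, the answer to the decision problem of whether $\mathsf{P}_{\mathrm{chio}}[\mathcal{E}_B^J]=\mathsf{P}_{\mathrm{lcf}}[\mathcal{E}_B^J]$ can be computed in time $O(|p_1(I)|\cdot|p_2(I)|)\subseteq O(n^2)$. However, there does not exist a fixed algorithm (having only entry-wise access to $B$ and no further a priori information) which decides that question on arbitrary instances $B\in\{0,\pm\}^I$ with $\emptyset\subseteq I\subseteq[n-1]^2$ in time $o(|p_1(I)|\cdot|p_2(I)|)$.
   Context: Asymptotic statements refer to $n\to\infty$ and to sequences $I=I(n)\subseteq[n-1]^2$ of index sets with $|I(n)|\to\infty$. "Entry-wise access" means that the algorithm learns about $B$ only by querying single entries $B[i,j]$, $(i,j)\in I$, each query costing at least one time unit. Notation: $[n]=\{1,\dots,n\}$, $n\ge2$, $\{\pm\}=\{-1,+1\}$, $\{0,\pm\}=\{-1,0,+1\}$; $p_1,p_2$ are the projections of $[n-1]^2$ to the first and second factor. Chio extension: for $J\subseteq[n-1]^2$, $\breve J:=\{(n,n)\}\cup\{(i,n):i\in p_1(J)\}\cup\{(n,j):j\in p_2(J)\}\cup J$. Chio map: $\tfrac12 C^{\breve J}_{(n,n)}:\{\pm\}^{\breve J}\to\{0,\pm\}^J$, $A=(a_{i,j})\mapsto\bigl(\tfrac12(a_{i,j}a_{n,n}-a_{i,n}a_{n,j})\bigr)_{(i,j)\in J}$. Chio measure: for $\mathcal{B}\subseteq\{0,\pm\}^J$, $\mathsf{P}_{\mathrm{chio}}[\mathcal{B}]:=2^{-|\breve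 J|}\sum_{B\in\mathcal{B}}|(\tfrac12C^{\breve J}_{(n,n)})^{-1}(B)|$. Lazy coin flip measure: $\mathsf{P}_{\mathrm{lcf}}$ is the probability measure on $\{0,\pm\}^J$ under which the entries are independent, each taking the values $-1,0,+1$ with probabilities $\tfrac14,\tfrac12,\tfrac14$. Entry-specification event: for $I\subseteq J$ and $B\in\{0,\pm\}^I$, $\mathcal{E}_B^J:=\{\tilde B\in\{0,\pm\}^J:\tilde B|_I=B\}$. *)

theory Defs
  imports "HOL-Probability.Product_PMF" "HOL-Library.Landau_Symbols"
begin

section \<open>Chio measure and lazy coin flip measure\<close>

type_synonym index = "nat \<times> nat"

definition grid :: "nat \<Rightarrow> index set" where
  "grid n = {1..n - 1} \<times> {1..n - 1}"

text \<open>A matrix with index set \<open>J\<close> is an extensional function on \<open>J\<close> with integer values.\<close>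

definition signs :: "index set \<Rightarrow> (index \<Rightarrow> int) set" where
  "signs J = J \<rightarrow>\<^sub>E {-1, 1}"

definition zero_signs :: "index set \<Rightarrow> (index \<Rightarrow> int) set" where
  "zero_signs J = J \<rightarrow>\<^sub>E {-1, 0, 1}"

definition chio_ext :: "nat \<Rightarrow> index set \<Rightarrow> index set" where
  "chio_ext n J = {(n, n)} \<union> {(i, n) | i. i \<in> fst ` J} \<union> {(n, j) | j. j \<in> snd ` J} \<union> J"

text \<open>On sign matrices the dividend lies in \<open>{-2, 0, 2}\<close>, so the integer division is exact.\<close>

definition half_chio :: "nat \<Rightarrow> index set \<Rightarrow> (index \<Rightarrow> int) \<Rightarrow> index \<Rightarrow> int" where
  "half_chio n J A =
     restrict (\<lambda>(i, j). (A (i, j) * A (n, n) - A (i, n) * A (n, j)) div 2) J"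

definition P_chio :: "nat \<Rightarrow> index set \<Rightarrow> (index \<Rightarrow> int) set \<Rightarrow> real" where
  "P_chio n J \<B> =
     (\<Sum>B\<in>\<B>. real (card {A \<in> signs (chio_ext n J). half_chio n J A = B}))
       / 2 ^ card (chio_ext n J)"

definition lazy_coin :: "int pmf" where
  "lazy_coin = pmf_of_list [(-1, 1 / 4), (0, 1 / 2), (1, 1 / 4)]"

text \<open>The default value \<open>undefined\<close> makes the product supported on extensional functions.\<close>

definition P_lcf :: "index set \<Rightarrow> (index \<Rightarrow> int) set \<Rightarrow> real" where
  "P_lcf J \<B> = measure_pmf.prob (Pi_pmf J undefined (\<lambda>_. lazy_coin)) \<B>"

definition entry_event :: "index set \<Rightarrow> index set \<Rightarrow> (index \<Rightarrow> int) \<Rightarrow> (index \<Rightarrow> int) set" where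
  "entry_event I J B = {B' \<in> zero_signs J. restrict B' I = B}"


section \<open>Algorithms with entry-wise access\<close>

text \<open>
  An algorithm is a deterministic transition system.  Its start state may depend on \<open>n\<close> and
  on the index set \<open>I\<close>, but on the matrix \<open>B\<close> only through the replies to its queries.
  Each transition takes one time unit.
\<close>

datatype 's action =
    Answer bool
  | Work 's
  | Query index "int \<Rightarrow> 's"

datatype 's algorithm =
  Algorithm (start: "nat \<Rightarrow> index set \<Rightarrow> 's") (action: "'s \<Rightarrow> 's action")

text \<open>
  Querying a position outside \<open>I\<close> is illegal: the state is repeated forever, so such a run
  never produces an answer.
\<close>

definition step ::
  "'s algorithm \<Rightarrow> index set \<Rightarrow> (index \<Rightarrow> int) \<Rightarrow> 's \<Rightarrow> 's" where
  "step A I B s =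
     (case action A s of
        Answer b \<Rightarrow> s
      | Work s' \<Rightarrow> s'
      | Query p f \<Rightarrow> if p \<in> I then f (B p) else s)"

definition state_at ::
  "'s algorithm \<Rightarrow> nat \<Rightarrow> index set \<Rightarrow> (index \<Rightarrow> int) \<Rightarrow> nat \<Rightarrow> 's" where
  "state_at A n I B t = (step A I B ^^ t) (start A n I)"

definition answer_at ::
  "'s algorithm \<Rightarrow> nat \<Rightarrow> index set \<Rightarrow> (index \<Rightarrow> int) \<Rightarrow> nat \<Rightarrow> bool option" where
  "answer_at A n I B t =
     (case action A (state_at A n I B t) of Answer b \<Rightarrow> Some b | _ \<Rightarrow> None)"

definition run_time ::
  "'s algorithm \<Rightarrow> nat \<Rightarrow> index set \<Rightarrow> (index \<Rightarrow> int) \<Rightarrow> nat" where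
  "run_time A n I B = (LEAST t. answer_at A n I B t \<noteq> None)"

definition worst_time :: "'s algorithm \<Rightarrow> nat \<Rightarrow> index set \<Rightarrow> nat" where
  "worst_time A n I = Max (run_time A n I ` zero_signs I)"

definition decides_chio_eq_lcf :: "'s algorithm \<Rightarrow> bool" where
  "decides_chio_eq_lcf A \<longleftrightarrow>
     (\<forall>n\<ge>2. \<forall>I J. I \<subseteq> J \<longrightarrow> J \<subseteq> grid n \<longrightarrow> (\<forall>B\<in>zero_signs I. \<exists>t.
        answer_at A n I B t =
          Some (P_chio n J (entry_event I J B) = P_lcf J (entry_event I J B))))"

definition growing_index_sets :: "(nat \<Rightarrow> index set) \<Rightarrow> bool" where
  "growing_index_sets I \<longleftrightarrow>
     (\<forall>n\<ge>2. I n \<subseteq> grid n) \<and> filterlim (\<lambda>n. card (I n)) at_top at_top"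


section \<open>Random access machines\<close>

text \<open>
  A unit-cost random access machine with addition and subtraction as its only arithmetic.
  A program names a fixed finite set of registers; the unbounded memory is reached through
  addresses held in registers.
\<close>

datatype instr =
    Const nat int
  | Add nat nat nat
  | Sub nat nat nat
  | Load nat nat
  | Store nat nat
  | Jump nat
  | Jump_Zero nat nat
  | Jump_Pos nat nat
  | Read_Entry nat nat nat
  | Output bool

type_synonym ram_state = "nat \<times> (nat \<Rightarrow> int) \<times> (int \<Rightarrow> int)"

fun exec :: "instr \<Rightarrow> ram_state \<Rightarrow> ram_state action" where
  "exec (Const r c) (pc, R, M) = Work (pc + 1, R(r := c), M)"
| "exec (Add r s t) (pc, R, M) = Work (pc + 1, R(r := R s + R t), M)"
| "exec (Sub r s t) (pc, R, M) = Work (pc + 1, R(r := R s - R t), M)"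
| "exec (Load r s) (pc, R, M) = Work (pc + 1, R(r := M (R s)), M)"
| "exec (Store r s) (pc, R, M) = Work (pc + 1, R, M(R r := R s))"
| "exec (Jump l) (pc, R, M) = Work (l, R, M)"
| "exec (Jump_Zero r l) (pc, R, M) = Work (if R r = 0 then l else pc + 1, R, M)"
| "exec (Jump_Pos r l) (pc, R, M) = Work (if R r > 0 then l else pc + 1, R, M)"
| "exec (Read_Entry r s t) (pc, R, M) =
     Query (nat (R s), nat (R t)) (\<lambda>b. (pc + 1, R(r := b), M))"
| "exec (Output b) (pc, R, M) = Answer b"

text \<open>A program counter outside the program makes the machine loop forever.\<close>

definition ram_action :: "instr list \<Rightarrow> ram_state \<Rightarrow> ram_state action" where
  "ram_action P s = (if fst s < length P then exec (P ! fst s) s else Work s)"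

definition row_major :: "index set \<Rightarrow> index list" where
  "row_major I =
     [(i, j). i \<leftarrow> sorted_list_of_set (fst ` I), j \<leftarrow> sorted_list_of_set (snd ` I), (i, j) \<in> I]"

definition input_word :: "index set \<Rightarrow> int list" where
  "input_word I = concat (map (\<lambda>(i, j). [int i, int j]) (row_major I))"

text \<open>
  Initially register 0 holds \<open>n\<close>, register 1 holds \<open>\<bar>I\<bar>\<close>, and the memory
  holds the elements of \<open>I\<close> as consecutive pairs from address 0 on; all else is 0.
\<close>

definition ram_start :: "nat \<Rightarrow> index set \<Rightarrow> ram_state" where
  "ram_start n I =
     (0,
      (\<lambda>_. 0)(0 := int n, 1 := int (card I)),
      (\<lambda>a. if 0 \<le> a \<and> a < int (length (input_word I)) then input_word I ! nat a else 0))"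

definition ram :: "instr list \<Rightarrow> ram_state algorithm" where
  "ram P = Algorithm ram_start (ram_action P)"

end

theory Submission
  imports Defs
begin

text \<open>
  A sign matrix maps to \<open>B\<close> on \<open>I\<close> iff its entries on \<open>I\<close> are as prescribed by the border and
  \<open>B\<close>, and the border signs \<open>x\<^sub>i y\<^sub>j\<close> equal \<open>-B(i, j)\<close> on the nonzero entries. Reveal the entries one
  at a time: the Chio probability is multiplied by the lazy coin probability of the new entry,
  unless this entry is nonzero and closes a cycle in the bipartite graph of the nonzero entries. In
  that case \<open>x\<^sub>i y\<^sub>j\<close> is already determined, and the quotient of the two measures drops to 0 or
  doubles. Hence the measures agree iff the graph is a forest.

  Upper bound: reading the entries row by row, keep component labels of the columns only. An edge
  closes a cycle iff its column's component was already met by the same row, and all components met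
  by a row are merged in one pass over the columns when the row ends.

  Lower bound: on the full grid let \<open>B\<close> be 1 on the first row and the first column and 0 elsewhere.
  This is a spanning tree, so changing any of the other \<open>(n - 2)\<^sup>2\<close> entries to 1 changes the answer,
  and all of them must be queried.
\<close>

section \<open>The measures agree exactly on forests\<close>

text \<open>
  The matrix entries are the edges of a bipartite graph on rows and columns. Connectedness of the
  end points of \<open>e\<close> is encoded by two-colourings: every colouring \<open>(x, y)\<close> of rows and columns
  that is constant along \<open>D\<close> gives both end points the same colour.
\<close>

definition closes_cycle :: "index set \<Rightarrow> index \<Rightarrow> bool" where
  "closes_cycle D e \<longleftrightarrow>
     (\<forall>x y :: nat \<Rightarrow> bool. (\<forall>(i, j)\<in>D. x i = y j) \<longrightarrow> x (fst e) = y (snd e))"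

lemma closes_cycle_mono: "closes_cycle D e \<Longrightarrow> D \<subseteq> D' \<Longrightarrow> closes_cycle D' e"
  unfolding closes_cycle_def by blast

text \<open>The edges are inserted one by one, \<open>D\<close> holding those revealed so far. An
  edge set is a forest iff no edge, at its insertion, joins two vertices that are already
  connected.\<close>

fun acyclic_from :: "(index \<Rightarrow> int) \<Rightarrow> index set \<Rightarrow> index list \<Rightarrow> bool" where
  "acyclic_from B D [] \<longleftrightarrow> True"
| "acyclic_from B D (e # es) \<longleftrightarrow>
     (if B e = 0 then acyclic_from B D es
      else \<not> closes_cycle D e \<and> acyclic_from B (insert e D) es)"

section \<open>Counting tools and lazy coin probabilities\<close>

text \<open>\<open>f\<close> pairs the elements with \<open>P\<close> and those without. Every
  factor 1/2 in the counts of sign matrices below comes from such a pairing.\<close>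

lemma card_halved_by_involution:
  assumes "finite X"
    and "\<And>x. x \<in> X \<Longrightarrow> f x \<in> X" "\<And>x. x \<in> X \<Longrightarrow> f (f x) = x"
    and "\<And>x. x \<in> X \<Longrightarrow> P (f x) \<longleftrightarrow> \<not> P x"
  shows "2 * card {x \<in> X. P x} = card X"
proof -
  have "bij_betw f {x \<in> X. P x} {x \<in> X. \<not> P x}"
    by (rule bij_betw_byWitness[where f' = f]) (use assms in auto)
  then have "card {x \<in> X. P x} = card {x \<in> X. \<not> P x}"
    by (rule bij_betw_same_card)
  moreover have "card X = card {x \<in> X. P x} + card {x \<in> X. \<not> P x}"
    by (subst card_Un_disjoint[symmetric]) (use assms(1) in \<open>auto intro: arg_cong[where f = card]\<close>)
  ultimately show ?thesis by simp
qed

lemma sum_card_fibres: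
  assumes "finite X" "finite Y"
  shows "(\<Sum>y\<in>Y. card {x \<in> X. f x = y}) = card {x \<in> X. f x \<in> Y}"
proof -
  have "card (\<Union>y\<in>Y. {x \<in> X. f x = y}) = (\<Sum>y\<in>Y. card {x \<in> X. f x = y})"
    by (rule card_UN_disjoint) (use assms in auto)
  moreover have "(\<Union>y\<in>Y. {x \<in> X. f x = y}) = {x \<in> X. f x \<in> Y}" by auto
  ultimately show ?thesis by simp
qed

lemma pmf_lazy_coin:
  "pmf lazy_coin (-1) = 1 / 4" "pmf lazy_coin 0 = 1 / 2" "pmf lazy_coin 1 = 1 / 4"
proof -
  have *: "pmf_of_list_wf [(-1 :: int, 1 / 4 :: real), (0, 1 / 2), (1, 1 / 4)]"
    by (auto simp: pmf_of_list_wf_def)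
  show "pmf lazy_coin (-1) = 1 / 4" "pmf lazy_coin 0 = 1 / 2" "pmf lazy_coin 1 = 1 / 4"
    unfolding lazy_coin_def by (simp_all add: pmf_pmf_of_list[OF *])
qed

lemma prob_lazy_coin_total: "measure_pmf.prob lazy_coin {-1, 0, 1} = 1"
  by (simp add: measure_measure_pmf_finite pmf_lazy_coin)

text \<open>The event is a box: one value at each position of \<open>I\<close>, all three values
  elsewhere. The factors outside \<open>I\<close> are 1, so \<open>J\<close> drops out.\<close>

lemma P_lcf_entry_event:
  assumes "finite J" "I \<subseteq> J" "B \<in> zero_signs I"
  shows "P_lcf J (entry_event I J B) = (\<Prod>p\<in>I. pmf lazy_coin (B p))"
proof -
  have "entry_event I J B = PiE_dflt J undefined (\<lambda>p. if p \<in> I then {B p} else {-1, 0, 1})"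
  proof (intro set_eqI iffI)
    fix B' assume "B' \<in> entry_event I J B"
    then have *: "B' \<in> zero_signs J" "restrict B' I = B" by (auto simp: entry_event_def)
    then show "B' \<in> PiE_dflt J undefined (\<lambda>p. if p \<in> I then {B p} else {-1, 0, 1})"
      by (auto simp: PiE_dflt_def zero_signs_def PiE_def extensional_def Pi_def)
  next
    fix B' assume *: "B' \<in> PiE_dflt J undefined (\<lambda>p. if p \<in> I then {B p} else {-1, 0, 1})"
    then have J: "B' p \<in> (if p \<in> I then {B p} else {-1, 0, 1})" if "p \<in> J" for p
      using that unfolding PiE_dflt_def by blast
    then have "B' p = B p" if "p \<in> I" for p
      using that assms(2) by (metis singletonD subsetD)
    moreover have "B \<in> extensional I" "\<And>p. p \<in> I \<Longrightarrow> B p \<in> {-1, 0, 1}"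
      using assms by (auto simp: zero_signs_def PiE_def)
    ultimately have "restrict B' I = B"
      by (auto simp: restrict_def extensional_def)
    moreover have "B' \<in> zero_signs J"
    proof -
      have "B' p \<in> {-1, 0, 1}" if "p \<in> J" for p
        using J[OF that] \<open>\<And>p. p \<in> I \<Longrightarrow> B p \<in> {-1, 0, 1}\<close>[of p]
        by (auto split: if_splits)
      moreover have "B' p = undefined" if "p \<notin> J" for p
        using * that unfolding PiE_dflt_def by blast
      ultimately show ?thesis by (auto simp: zero_signs_def PiE_def extensional_def)
    qed
    ultimately show "B' \<in> entry_event I J B" by (simp add: entry_event_def)
  qed
  then have "P_lcf J (entry_event I J B) =
      (\<Prod>p\<in>J. measure_pmf.prob lazy_coin (if p \<in> I then {B p} else {-1, 0, 1}))"
    unfolding P_lcf_def using measure_Pi_pmf_PiE_dflt[OF assms(1)] by simp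
  also have "\<dots> = (\<Prod>p\<in>J. if p \<in> I then pmf lazy_coin (B p) else 1)"
    by (intro prod.cong) (auto simp: prob_lazy_coin_total measure_pmf_single)
  also have "\<dots> = (\<Prod>p\<in>I. pmf lazy_coin (B p))"
    using assms by (subst prod.inter_restrict[symmetric]) (auto simp: Int_absorb1)
  finally show ?thesis .
qed

lemma sign_product_eq_iff:
  fixes a b c d :: int
  assumes "a = 1 \<or> a = -1" "b = 1 \<or> b = -1" "c = 1 \<or> c = -1" "d = 1 \<or> d = -1"
  shows "a * b = c * d \<longleftrightarrow> (a = c \<longleftrightarrow> b = d)"
  using assms by (elim disjE) simp_all

section \<open>Counting the sign matrices with a partially prescribed Chio image\<close>

locale chio_instance =
  fixes n :: nat and I J :: "index set" and B :: "index \<Rightarrow> int"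
  assumes I_subset: "I \<subseteq> J" and J_subset: "J \<subseteq> grid n" and B_entries: "B \<in> zero_signs I"
begin

text \<open>All signs on the extension of the whole of \<open>J\<close> are counted, whatever
  \<open>K\<close> is, so that cardinalities for different \<open>K\<close> can be compared.\<close>

definition matching :: "index set \<Rightarrow> (index \<Rightarrow> int) set" where
  "matching K = {A \<in> signs (chio_ext n J). \<forall>p\<in>K. half_chio n J A p = B p}"

definition edges :: "index set \<Rightarrow> index set" where
  "edges K = {p \<in> K. B p \<noteq> 0}"

definition weight :: "index set \<Rightarrow> real" where
  "weight K = (\<Prod>p\<in>K. pmf lazy_coin (B p))"

lemma finite_J [simp]: "finite J"
  using finite_subset[OF J_subset] by (simp add: grid_def)

lemma finite_I [simp]: "finite I"
  using finite_subset[OF I_subset] by simp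

lemma finite_chio_ext [simp]: "finite (chio_ext n J)"
proof -
  have "chio_ext n J = {(n, n)} \<union> (\<lambda>i. (i, n)) ` fst ` J \<union> (\<lambda>j. (n, j)) ` snd ` J \<union> J"
    unfolding chio_ext_def by auto
  then show ?thesis by simp
qed

lemma finite_signs [simp]: "finite (signs (chio_ext n J))"
  unfolding signs_def by (intro finite_PiE) auto

lemma card_signs: "card (signs (chio_ext n J)) = 2 ^ card (chio_ext n J)"
  unfolding signs_def by (simp add: card_PiE numeral_2_eq_2)

lemma J_bounds: "(i, j) \<in> J \<Longrightarrow> i < n \<and> j < n"
  using J_subset by (fastforce simp: grid_def)

lemma B_cases: "p \<in> I \<Longrightarrow> B p = -1 \<or> B p = 0 \<or> B p = 1"
  using B_entries by (auto simp: zero_signs_def PiE_def)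

lemma signs_cases: "A \<in> signs X \<Longrightarrow> p \<in> X \<Longrightarrow> A p = 1 \<or> A p = -1"
  by (auto simp: signs_def PiE_def)

lemma in_chio_ext:
  assumes "(i, j) \<in> J"
  shows "(i, j) \<in> chio_ext n J" "(i, n) \<in> chio_ext n J" "(n, j) \<in> chio_ext n J"
    "(n, n) \<in> chio_ext n J"
  using assms unfolding chio_ext_def by force+

lemma entry_signs:
  assumes "A \<in> signs (chio_ext n J)" "(i, j) \<in> J"
  shows "A (i, j) = 1 \<or> A (i, j) = -1" "A (i, n) = 1 \<or> A (i, n) = -1"
    "A (n, j) = 1 \<or> A (n, j) = -1" "A (n, n) = 1 \<or> A (n, n) = -1"
  using signs_cases[OF assms(1)] in_chio_ext[OF assms(2)] by auto

lemma half_chio_zero_iff: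
  assumes "A \<in> signs (chio_ext n J)" "(i, j) \<in> J"
  shows "half_chio n J A (i, j) = 0 \<longleftrightarrow> A (i, j) * A (n, n) = A (i, n) * A (n, j)"
  using entry_signs[OF assms] assms(2) by (auto simp: half_chio_def)

text \<open>Half the difference of two signs is a sign \<open>b\<close> only if the first is
  \<open>b\<close> and the second \<open>-b\<close>. The second equation constrains the border
  alone; this is what makes nonzero entries edges.\<close>

lemma half_chio_nonzero_iff:
  assumes "A \<in> signs (chio_ext n J)" "(i, j) \<in> J" "b = 1 \<or> b = -1"
  shows "half_chio n J A (i, j) = b \<longleftrightarrow> A (i, j) * A (n, n) = b \<and> A (i, n) * A (n, j) = -b"
  using entry_signs[OF assms(1,2)] assms(2,3) by (auto simp: half_chio_def)

lemma half_chio_in_zero_signs: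
  assumes "A \<in> signs (chio_ext n J)"
  shows "half_chio n J A \<in> zero_signs J"
proof -
  have "half_chio n J A p \<in> {-1, 0, 1}" if "p \<in> J" for p
    using entry_signs[OF assms, of "fst p" "snd p"] that
    by (cases p) (auto simp: half_chio_def)
  then show ?thesis by (auto simp: zero_signs_def PiE_def half_chio_def)
qed

lemma P_chio_entry_event:
  "P_chio n J (entry_event I J B) = card (matching I) / card (signs (chio_ext n J))"
proof -
  have "finite (entry_event I J B)"
    unfolding entry_event_def zero_signs_def by (simp add: finite_PiE)
  then have "(\<Sum>B'\<in>entry_event I J B. card {A \<in> signs (chio_ext n J). half_chio n J A = B'}) =
      card {A \<in> signs (chio_ext n J). half_chio n J A \<in> entry_event I J B}"
    by (intro sum_card_fibres) auto
  also have "{A \<in> signs (chio_ext n J). half_chio n J A \<in> entry_event I J B} = matching I"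
  proof -
    have "restrict f I = B \<longleftrightarrow> (\<forall>p\<in>I. f p = B p)" for f
      using B_entries by (auto simp: zero_signs_def PiE_def extensional_def restrict_def fun_eq_iff)
    then show ?thesis
      using half_chio_in_zero_signs by (auto simp: entry_event_def matching_def)
  qed
  finally show ?thesis
    by (simp add: P_chio_def card_signs flip: of_nat_sum)
qed

lemma finite_matching [simp]: "finite (matching K)"
  unfolding matching_def by simp

text \<open>An entry off row \<open>n\<close> and column \<open>n\<close> influences only the Chio
  entry at its own position.\<close>

lemma flip_entry:
  assumes "A \<in> matching K" "K \<subseteq> J" "(i, j) \<in> J - K"
  shows "A((i, j) := - A (i, j)) \<in> matching K"
proof -
  have *: "i < n" "j < n" using assms(3) J_bounds by auto
  have A: "A \<in> signs (chio_ext n J)" using assms(1) by (simp add: matching_def)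
  have "A((i, j) := - A (i, j)) \<in> signs (chio_ext n J)"
    using A entry_signs[OF A, of i j] assms(3) in_chio_ext(1)[of i j]
    by (auto simp: signs_def PiE_def Pi_def extensional_def)
  moreover have "half_chio n J (A((i, j) := - A (i, j))) p = half_chio n J A p" if "p \<in> K" for p
    using that * assms(2,3) by (cases p) (auto simp: half_chio_def)
  ultimately show ?thesis using assms(1) by (auto simp: matching_def)
qed

text \<open>Whatever the border is, exactly one of the two values of the free entry at
  \<open>p\<close> produces a 0.\<close>

lemma card_matching_zero:
  assumes "K \<subseteq> I" "p \<in> I - K" "B p = 0"
  shows "2 * card (matching (insert p K)) = card (matching K)"
proof -
  obtain i j where p: "p = (i, j)" by (cases p)
  have pJ: "(i, j) \<in> J" "K \<subseteq> J" "(i, j) \<in> J - K" using assms p I_subset by auto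
  have "2 * card {A \<in> matching K. A (i, j) * A (n, n) = A (i, n) * A (n, j)} = card (matching K)"
  proof (rule card_halved_by_involution[where f = "\<lambda>A. A((i, j) := - A (i, j))"])
    fix A assume A: "A \<in> matching K"
    then show "A((i, j) := - A (i, j)) \<in> matching K" using flip_entry pJ by blast
    have "A \<in> signs (chio_ext n J)" using A by (simp add: matching_def)
    from entry_signs[OF this pJ(1)] J_bounds[OF pJ(1)]
    show "((A((i, j) := - A (i, j))) (i, j) * (A((i, j) := - A (i, j))) (n, n) =
           (A((i, j) := - A (i, j))) (i, n) * (A((i, j) := - A (i, j))) (n, j)) \<longleftrightarrow>
          \<not> A (i, j) * A (n, n) = A (i, n) * A (n, j)"
      by auto
  qed auto
  moreover have "{A \<in> matching K. A (i, j) * A (n, n) = A (i, n) * A (n, j)} = matching (insert p K)"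
    using assms(3) p half_chio_zero_iff[OF _ pJ(1)] by (auto simp: matching_def)
  ultimately show ?thesis by simp
qed

text \<open>Once the border product is right, exactly one value of the free entry at
  \<open>(i, j)\<close> works. What remains is how often the border product is right.\<close>

lemma card_matching_nonzero:
  assumes "K \<subseteq> I" "(i, j) \<in> I - K" "B (i, j) \<noteq> 0"
  shows "2 * card (matching (insert (i, j) K)) =
    card {A \<in> matching K. A (i, n) * A (n, j) = - B (i, j)}" (is "_ = card ?G")
proof -
  have pJ: "(i, j) \<in> J" "K \<subseteq> J" "(i, j) \<in> J - K" using assms I_subset by auto
  have b: "B (i, j) = 1 \<or> B (i, j) = -1" using B_cases assms by blast
  have "2 * card {A \<in> ?G. A (i, j) * A (n, n) = B (i, j)} = card ?G"
  proof (rule card_halved_by_involution[where f = "\<lambda>A. A((i, j) := - A (i, j))"])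
    fix A assume A: "A \<in> ?G"
    then show "A((i, j) := - A (i, j)) \<in> ?G"
      using flip_entry[OF _ pJ(2,3)] J_bounds[OF pJ(1)] by auto
    have "A \<in> signs (chio_ext n J)" using A by (simp add: matching_def)
    from entry_signs[OF this pJ(1)] J_bounds[OF pJ(1)] b
    show "((A((i, j) := - A (i, j))) (i, j) * (A((i, j) := - A (i, j))) (n, n) = B (i, j)) \<longleftrightarrow>
          \<not> A (i, j) * A (n, n) = B (i, j)"
      by auto
  qed auto
  moreover have "{A \<in> ?G. A (i, j) * A (n, n) = B (i, j)} = matching (insert (i, j) K)"
    using half_chio_nonzero_iff[OF _ pJ(1) b] by (auto simp: matching_def)
  ultimately show ?thesis by simp
qed

text \<open>
  Multiplying row \<open>i\<close> of \<open>A\<close> by \<open>\<plusminus>1\<close> and column \<open>j\<close> by \<open>\<plusminus>1\<close> according to a two-colouring,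
  with row \<open>n\<close> and column \<open>n\<close> kept, multiplies entry \<open>(i, j)\<close> of the Chio image by the product of
  the two signs. A colouring that is constant on the edges therefore preserves \<open>matching K\<close>.
\<close>

lemma card_matching_acyclic:
  assumes "K \<subseteq> I" "(i, j) \<in> I - K" "B (i, j) \<noteq> 0" "\<not> closes_cycle (edges K) (i, j)"
  shows "4 * card (matching (insert (i, j) K)) = card (matching K)"
proof -
  have pJ: "(i, j) \<in> J" "K \<subseteq> J" using assms I_subset by auto
  note ij = J_bounds[OF pJ(1)]
  have b: "B (i, j) = 1 \<or> B (i, j) = -1" using B_cases assms by blast
  obtain x y :: "nat \<Rightarrow> bool" where xy: "\<forall>(k, l)\<in>edges K. x k = y l" "x i \<noteq> y j"
    using assms(4) by (auto simp: closes_cycle_def)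
  define r :: "nat \<Rightarrow> int" where "r k = (if k = n \<or> x k then 1 else -1)" for k
  define s :: "nat \<Rightarrow> int" where "s k = (if k = n \<or> y k then 1 else -1)" for k
  define f where "f A = restrict (\<lambda>(k, l). A (k, l) * (r k * s l)) (chio_ext n J)" for A :: "index \<Rightarrow> int"
  have r: "r k = 1 \<or> r k = -1" and s: "s k = 1 \<or> s k = -1" for k
    by (auto simp: r_def s_def)
  have rs: "r n = 1" "s n = 1" "r i * s j = -1"
    using xy(2) ij by (auto simp: r_def s_def)
  have f_signs: "f A \<in> signs (chio_ext n J)" if A: "A \<in> signs (chio_ext n J)" for A
  proof -
    have "f A p \<in> {-1, 1}" if "p \<in> chio_ext n J" for p
      using that signs_cases[OF A that] r[of "fst p"] s[of "snd p"]
      by (auto simp: f_def split: prod.splits)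
    then show ?thesis by (auto simp: signs_def PiE_def f_def)
  qed
  have f_half: "half_chio n J (f A) (k, l) = r k * s l * half_chio n J A (k, l)"
    if A: "A \<in> signs (chio_ext n J)" and kl: "(k, l) \<in> J" for A k l
    using entry_signs[OF A kl] in_chio_ext[OF kl] kl r[of k] s[of l] rs(1,2)
    by (auto simp: half_chio_def f_def)
  have "2 * card {A \<in> matching K. A (i, n) * A (n, j) = - B (i, j)} = card (matching K)"
  proof (rule card_halved_by_involution[where f = f])
    fix A assume "A \<in> matching K"
    then have A: "A \<in> signs (chio_ext n J)" and half: "\<forall>p\<in>K. half_chio n J A p = B p"
      by (auto simp: matching_def)
    have "half_chio n J (f A) (k, l) = B (k, l)" if kl: "(k, l) \<in> K" for k l
    proof (cases "B (k, l) = 0")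
      case True
      then show ?thesis using f_half[OF A] half kl pJ by auto
    next
      case False
      then have "(k, l) \<in> edges K" using kl by (simp add: edges_def)
      moreover have "k < n" "l < n" using kl pJ J_bounds by auto
      ultimately have "r k * s l = 1" using xy(1) by (auto simp: r_def s_def)
      then show ?thesis using f_half[OF A] half kl pJ by auto
    qed
    then show "f A \<in> matching K" using f_signs[OF A] by (auto simp: matching_def)
    have "f (f A) p = A p" for p
    proof (cases "p \<in> chio_ext n J")
      case True
      then show ?thesis using r[of "fst p"] s[of "snd p"] by (auto simp: f_def split: prod.splits)
    next
      case False
      then show ?thesis using PiE_arb[OF A[unfolded signs_def], of p] by (simp add: f_def)
    qed
    then show "f (f A) = A" by blast
    \<comment> \<open>The border product is multiplied by \<open>r i * s j\<close>, which is -1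
      because the colouring separates row \<open>i\<close> from column \<open>j\<close>.\<close>
    have "f A (i, n) * f A (n, j) = (r i * s j) * (A (i, n) * A (n, j))"
      using in_chio_ext[OF pJ(1)] rs(1,2) by (simp add: f_def)
    moreover have "A (i, n) * A (n, j) = 1 \<or> A (i, n) * A (n, j) = -1"
      using entry_signs(2,3)[OF A pJ(1)] by auto
    ultimately show "(f A (i, n) * f A (n, j) = - B (i, j)) \<longleftrightarrow> \<not> A (i, n) * A (n, j) = - B (i, j)"
      using rs(3) b by auto
  qed auto
  then show ?thesis using card_matching_nonzero[OF assms(1-3)] by linarith
qed

text \<open>Two elements of \<open>matching K\<close> define a two-colouring: mark where their borders agree.\<close>

lemma card_matching_cyclic:
  assumes "K \<subseteq> I" "(i, j) \<in> I - K" "B (i, j) \<noteq> 0" "closes_cycle (edges K) (i, j)"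
  shows "matching (insert (i, j) K) = {} \<or>
    2 * card (matching (insert (i, j) K)) = card (matching K)"
proof -
  let ?G = "{A \<in> matching K. A (i, n) * A (n, j) = - B (i, j)}"
  have pJ: "(i, j) \<in> J" "K \<subseteq> J" using assms I_subset by auto
  have const: "A (i, n) * A (n, j) = A' (i, n) * A' (n, j)"
    if "A \<in> matching K" "A' \<in> matching K" for A A'
  proof -
    have A: "A \<in> signs (chio_ext n J)" "A' \<in> signs (chio_ext n J)"
      and half: "\<forall>p\<in>K. half_chio n J A p = B p" "\<forall>p\<in>K. half_chio n J A' p = B p"
      using that by (auto simp: matching_def)
    have "(A (k, n) = A' (k, n)) = (A (n, l) = A' (n, l))" if kl: "(k, l) \<in> edges K" for k l
    proof -
      have kl': "(k, l) \<in> J" "(k, l) \<in> K" "B (k, l) = 1 \<or> B (k, l) = -1"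
        using kl pJ assms(1) B_cases[of "(k, l)"] by (auto simp: edges_def)
      have "A (k, n) * A (n, l) = - B (k, l)" "A' (k, n) * A' (n, l) = - B (k, l)"
        using half_chio_nonzero_iff[OF A(1) kl'(1,3)] half_chio_nonzero_iff[OF A(2) kl'(1,3)]
          half kl'(2) by auto
      then show ?thesis
        using sign_product_eq_iff[OF entry_signs(2,3)[OF A(1) kl'(1)] entry_signs(2,3)[OF A(2) kl'(1)]]
        by simp
    qed
    then have "(A (i, n) = A' (i, n)) = (A (n, j) = A' (n, j))"
      using assms(4)[unfolded closes_cycle_def, rule_format,
          of "\<lambda>k. A (k, n) = A' (k, n)" "\<lambda>l. A (n, l) = A' (n, l)"] by auto
    then show ?thesis
      using sign_product_eq_iff[OF entry_signs(2,3)[OF A(1) pJ(1)] entry_signs(2,3)[OF A(2) pJ(1)]]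
      by simp
  qed
  \<comment> \<open>The border product is constant on \<open>matching K\<close>, so the border
    condition holds everywhere or nowhere.\<close>
  have "?G = matching K" if "A \<in> ?G" for A
    using that const[of _ A] by auto
  then consider "?G = {}" | "?G = matching K" by blast
  then show ?thesis
  proof cases
    case 1
    then have "card (matching (insert (i, j) K)) = 0"
      using card_matching_nonzero[OF assms(1-3)] by (simp only: card.empty)
    then show ?thesis by simp
  next
    case 2
    then show ?thesis using card_matching_nonzero[OF assms(1-3)] by (simp only:) blast
  qed
qed

section \<open>The likelihood ratio of the two measures\<close>

definition ratio :: "index set \<Rightarrow> real" where
  "ratio K = card (matching K) / (card (signs (chio_ext n J)) * weight K)"

lemma weight_pos: "K \<subseteq> I \<Longrightarrow> weight K > 0"
  unfolding weight_def using B_cases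
  by (intro prod_pos) (metis divide_pos_pos pmf_lazy_coin subsetD zero_less_numeral zero_less_one)

lemma ratio_nonneg: "K \<subseteq> I \<Longrightarrow> ratio K \<ge> 0"
  unfolding ratio_def using weight_pos[of K] by simp

lemma ratio_empty: "ratio {} = 1"
proof -
  have "matching {} = signs (chio_ext n J)" by (simp add: matching_def)
  then show ?thesis by (simp add: ratio_def weight_def card_signs)
qed

lemma weight_insert:
  assumes "K \<subseteq> I" "p \<in> I - K"
  shows "weight (insert p K) = (if B p = 0 then 1 / 2 else 1 / 4) * weight K"
proof -
  have "finite K" using finite_subset[OF assms(1)] by simp
  then show ?thesis
    using assms B_cases[of p] by (auto simp: weight_def pmf_lazy_coin)
qed

lemma ratio_insert:
  assumes "K \<subseteq> I" "p \<in> I - K"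
  shows "ratio (insert p K) =
      (real (card (matching (insert p K))) * (if B p = 0 then 2 else 4)) /
        (card (signs (chio_ext n J)) * weight K)"
  using weight_insert[OF assms] by (simp add: ratio_def field_simps)

text \<open>Count and weight shrink alike: both by 1/2 at a zero entry, both by 1/4 at an edge
  closing no cycle.\<close>

lemma ratio_insert_acyclic:
  assumes "K \<subseteq> I" "p \<in> I - K" "B p = 0 \<or> \<not> closes_cycle (edges K) p"
  shows "ratio (insert p K) = ratio K"
proof -
  obtain i j where p: "p = (i, j)" by (cases p)
  have "card (matching (insert p K)) * (if B p = 0 then 2 else 4) = card (matching K)"
    using card_matching_zero[OF assms(1,2)] card_matching_acyclic[of K i j] assms p by auto
  then have "real (card (matching (insert p K))) * (if B p = 0 then 2 else 4) = card (matching K)"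
    by (auto dest: arg_cong[where f = real] split: if_splits)
  then show ?thesis unfolding ratio_insert[OF assms(1,2)] by (simp add: ratio_def)
qed

text \<open>The weight falls to a quarter, but the count vanishes or falls only to a half.\<close>

lemma ratio_insert_cyclic:
  assumes "K \<subseteq> I" "p \<in> I - K" "B p \<noteq> 0" "closes_cycle (edges K) p"
  shows "ratio (insert p K) = 0 \<or> ratio (insert p K) = 2 * ratio K"
proof -
  obtain i j where p: "p = (i, j)" by (cases p)
  have "card (matching (insert p K)) = 0 \<or> 2 * card (matching (insert p K)) = card (matching K)"
    using card_matching_cyclic[of K i j] assms p by auto
  then have "card (matching (insert p K)) = 0 \<or>
      real (card (matching (insert p K))) * 4 = 2 * card (matching K)"
    by linarith
  then show ?thesis
    unfolding ratio_insert[OF assms(1,2)] using assms(3) by (auto simp: ratio_def)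
qed

lemma edges_insert: "edges (insert p K) = (if B p = 0 then edges K else insert p (edges K))"
  by (auto simp: edges_def)

text \<open>The ratio never decreases to a positive value, so a doubling is never undone.\<close>

lemma ratio_append:
  assumes "distinct es" "set es \<subseteq> I" "K \<subseteq> I" "K \<inter> set es = {}"
  shows "if acyclic_from B (edges K) es then ratio (K \<union> set es) = ratio K
    else ratio (K \<union> set es) = 0 \<or> ratio (K \<union> set es) \<ge> 2 * ratio K"
  using assms
proof (induction es arbitrary: K)
  case Nil
  then show ?case by simp
next
  case (Cons p es)
  then have K: "K \<subseteq> I" "p \<in> I - K" "insert p K \<subseteq> I" by auto
  have IH: "if acyclic_from B (edges (insert p K)) es
    then ratio (insert p K \<union> set es) = ratio (insert p K)
    else ratio (insert p K \<union> set es) = 0 \<or> ratio (insert p K \<union> set es) \<ge> 2 * ratio (insert p K)"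
    by (rule Cons.IH) (use Cons.prems in auto)
  show ?case
  proof (cases "B p = 0 \<or> \<not> closes_cycle (edges K) p")
    case True
    then show ?thesis
      using IH ratio_insert_acyclic[OF K(1,2) True] by (auto simp: edges_insert split: if_splits)
  next
    case False
    then have insert: "ratio (insert p K) = 0 \<or> ratio (insert p K) = 2 * ratio K"
      using ratio_insert_cyclic[OF K(1,2)] by auto
    \<comment> \<open>Ratio 0 means that no sign matrix is left, and further prescribed entries
      cannot bring one back.\<close>
    have "ratio (insert p K \<union> set es) = 0" if "ratio (insert p K) = 0"
    proof -
      have "matching (insert p K) = {}"
        using that weight_pos[OF K(3)] by (auto simp: ratio_def card_signs)
      then have "matching (insert p K \<union> set es) = {}" by (auto simp: matching_def)
      then show ?thesis by (simp add: ratio_def)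
    qed
    then show ?thesis
      using insert IH False ratio_nonneg[OF K(1)] by (auto split: if_splits)
  qed
qed

text \<open>The measures agree iff the ratio at \<open>I\<close> is 1. It starts at 1 and either
  stays there or ends at 0 or at least 2. Any enumeration \<open>es\<close> of \<open>I\<close> will
  do.\<close>

lemma chio_eq_lcf_iff_acyclic:
  assumes "distinct es" "set es = I"
  shows "P_chio n J (entry_event I J B) = P_lcf J (entry_event I J B) \<longleftrightarrow> acyclic_from B {} es"
proof -
  have "a / c = w \<longleftrightarrow> a / (c * w) = 1" if "c > 0" "w > 0" for a c w :: real
    using that by (auto simp: field_simps)
  from this[of "card (signs (chio_ext n J))" "weight I" "card (matching I)"] weight_pos[of I]
  have "P_chio n J (entry_event I J B) = P_lcf J (entry_event I J B) \<longleftrightarrow> ratio I = 1"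
    using P_lcf_entry_event[OF finite_J I_subset B_entries] P_chio_entry_event
    by (simp add: ratio_def weight_def card_signs)
  also have "\<dots> \<longleftrightarrow> acyclic_from B {} es"
    using ratio_append[of es "{}"] assms ratio_empty by (auto simp: edges_def split: if_splits)
  finally show ?thesis .
qed

text \<open>An edge that closes no cycle with all other edges closes none with the earlier ones
  either, by monotonicity. This is an order-free criterion for the lower bound.\<close>

lemma chio_eq_lcfI:
  assumes "\<And>p. p \<in> I \<Longrightarrow> B p \<noteq> 0 \<Longrightarrow> \<not> closes_cycle {q \<in> I. B q \<noteq> 0 \<and> q \<noteq> p} p"
  shows "P_chio n J (entry_event I J B) = P_lcf J (entry_event I J B)"
proof -
  obtain es where es: "set es = I" "distinct es" using finite_distinct_list[OF finite_I] by auto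
  have "acyclic_from B D es'"
    if "distinct es'" "set es' \<subseteq> I" "D \<subseteq> I" "D \<inter> set es' = {}" "\<forall>p\<in>D. B p \<noteq> 0" for D es'
    using that
  proof (induction es' arbitrary: D)
    case (Cons p es')
    have "\<not> closes_cycle D p" if "B p \<noteq> 0"
      using assms[of p] that Cons.prems closes_cycle_mono[of D p "{q \<in> I. B q \<noteq> 0 \<and> q \<noteq> p}"] by auto
    moreover have "acyclic_from B D es'" using Cons by auto
    moreover have "acyclic_from B (insert p D) es'" if "B p \<noteq> 0"
      using Cons.prems that by (intro Cons.IH) auto
    ultimately show ?case by simp
  qed simp
  from this[of es "{}"] es show ?thesis using chio_eq_lcf_iff_acyclic[of es] by simp
qed

text \<open>Reveal \<open>p\<close> last: by then all other edges are present.\<close>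

lemma chio_neq_lcfI:
  assumes "p \<in> I" "B p \<noteq> 0" "closes_cycle {q \<in> I. B q \<noteq> 0 \<and> q \<noteq> p} p"
  shows "P_chio n J (entry_event I J B) \<noteq> P_lcf J (entry_event I J B)"
proof -
  obtain es where es: "set es = I - {p}" "distinct es"
    using finite_distinct_list[of "I - {p}"] by auto
  have last: "acyclic_from B D (es' @ [p]) \<longrightarrow> \<not> closes_cycle (D \<union> {q \<in> set es'. B q \<noteq> 0}) p" for D es'
  proof (induction es' arbitrary: D)
    case (Cons e es')
    have "{q \<in> set (e # es'). B q \<noteq> 0} =
        (if B e = 0 then {} else {e}) \<union> {q \<in> set es'. B q \<noteq> 0}" by auto
    then show ?case using Cons[of D] Cons[of "insert e D"] by (auto simp: insert_commute)
  qed (simp add: assms(2))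
  note last[of "{}" es]
  moreover have "{q \<in> I. B q \<noteq> 0 \<and> q \<noteq> p} = {q \<in> set es. B q \<noteq> 0}" using es by auto
  ultimately have "\<not> acyclic_from B {} (es @ [p])" using assms(3) by simp
  then show ?thesis using chio_eq_lcf_iff_acyclic[of "es @ [p]"] es assms(1) by auto
qed

end


section \<open>A random access machine recognising forests\<close>

text \<open>Each row forms one contiguous block, so the machine detects a new row by comparison with
  the previous one and never returns to an old row.\<close>

lemma sorted_row_major: "sorted (map fst (row_major I))"
proof -
  have *: "sorted (map fst (concat (map (\<lambda>i. concat (map (\<lambda>j. if (i, j) \<in> I then [(i, j)] else []) ys)) xs)))"
    if "sorted xs" for xs ys :: "nat list"
    using that
  proof (induction xs)
    case (Cons x xs)
    have "map fst (concat (map (\<lambda>j. if (x, j) \<in> I then [(x, j)] else []) ys)) =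
        replicate (length (filter (\<lambda>j. (x, j) \<in> I) ys)) x"
      by (induction ys) auto
    then show ?case using Cons by (fastforce simp: sorted_append)
  qed simp
  show ?thesis unfolding row_major_def by (rule *) simp
qed

lemma set_row_major: "finite I \<Longrightarrow> set (row_major I) = I"
  unfolding row_major_def by force

lemma distinct_row_major: "distinct (row_major I)"
proof -
  have *: "distinct (concat (map (\<lambda>i. concat (map (\<lambda>j. if (i, j) \<in> I then [(i, j)] else []) ys)) xs))"
    if "distinct xs" "distinct ys" for xs ys :: "nat list"
    using that(1)
  proof (induction xs)
    case (Cons x xs)
    have "distinct (concat (map (\<lambda>j. if (x, j) \<in> I then [(x, j)] else []) ys))"
      using that(2) by (induction ys) auto
    then show ?case using Cons by auto
  qed simp
  show ?thesis unfolding row_major_def by (rule *) simp_all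
qed

lemma length_row_major: "finite I \<Longrightarrow> length (row_major I) = card I"
  using distinct_card[OF distinct_row_major, of I] by (simp add: set_row_major)

lemma length_input_word: "length (input_word I) = 2 * length (row_major I)"
proof -
  have "length (concat (map (\<lambda>(i, j). [int i, int j]) xs)) = 2 * length xs" for xs
    by (induction xs) auto
  then show ?thesis by (simp add: input_word_def)
qed

lemma nth_input_word:
  assumes "k < length (row_major I)"
  shows "input_word I ! (2 * k) = int (fst (row_major I ! k))"
    "input_word I ! (2 * k + 1) = int (snd (row_major I ! k))"
proof -
  have "concat (map (\<lambda>(i, j). [int i, int j]) xs) ! (2 * k) = int (fst (xs ! k)) \<and>
      concat (map (\<lambda>(i, j). [int i, int j]) xs) ! (2 * k + 1) = int (snd (xs ! k))"
    if "k < length xs" for xs k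
    using that
  proof (induction xs arbitrary: k)
    case (Cons x xs)
    then show ?case by (cases x; cases k) auto
  qed simp
  then show "input_word I ! (2 * k) = int (fst (row_major I ! k))"
    "input_word I ! (2 * k + 1) = int (snd (row_major I ! k))"
    using assms unfolding input_word_def by blast+
qed

text \<open>
  Column \<open>j\<close> owns the cells \<open>ptr j = -3 j\<close> (its component label, itself the pointer of a column;
  0 if the column has not been seen), \<open>ptr j + 1\<close> (the last row with an edge into the component
  labelled \<open>ptr j\<close>) and \<open>ptr j + 2\<close> (the next seen column). Labels ignore the current row until
  it ends; then all components marked by it are merged.

  Registers: 1 number of entries left, 2 input address, 3 the constant 1, 4 and 5 current row and
  column, 6 row to which the marks refer, 7 matrix entry, 8 label, 9, 12 and 13 scratch, 10 a marked
  label, 11 head of the list of seen columns, 15 the constant 0.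
\<close>

definition forest_program :: "instr list" where
  "forest_program =
    [ \<comment> \<open>0\<close>  Const 3 1,
      \<comment> \<open>1: next entry\<close>
                Jump_Zero 1 45, Load 4 2, Add 2 2 3, Load 5 2, Add 2 2 3, Sub 1 1 3, Read_Entry 7 4 5,
      \<comment> \<open>8: new row?\<close>
                Sub 9 4 6, Jump_Zero 9 24, Add 12 11 15,
      \<comment> \<open>11: merge the components met by the old row\<close>
                Jump_Zero 12 23, Load 8 12, Add 13 8 3, Load 9 13, Sub 9 9 6, Jump_Zero 9 18, Jump 19,
      \<comment> \<open>18\<close> Store 12 10,
      \<comment> \<open>19\<close> Add 12 12 3, Add 12 12 3, Load 12 12, Jump 11,
      \<comment> \<open>23\<close> Add 6 4 15,
      \<comment> \<open>24: new column?\<close>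
                Sub 9 15 5, Sub 9 9 5, Sub 9 9 5, Load 8 9, Jump_Zero 8 30, Jump 36,
      \<comment> \<open>30\<close> Store 9 9, Add 8 9 15, Add 12 9 3, Add 12 12 3, Store 12 11, Add 11 9 15,
      \<comment> \<open>36: new edge\<close>
                Jump_Zero 7 1, Add 13 8 3, Load 12 13, Sub 12 12 6, Jump_Zero 12 44, Store 13 6,
                Add 10 8 15, Jump 1,
      \<comment> \<open>44\<close> Output False,
      \<comment> \<open>45\<close> Output True ]"

lemma step_ram:
  "step (ram P) I B (pc, R, M) =
     (if pc < length P then
        (case exec (P ! pc) (pc, R, M) of
           Answer b \<Rightarrow> (pc, R, M)
         | Work s \<Rightarrow> s
         | Query p f \<Rightarrow> if p \<in> I then f (B p) else (pc, R, M))
      else (pc, R, M))"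
  by (simp add: step_def ram_def ram_action_def split: action.split)

text \<open>Peels off the first step of a literal number of steps, so that the simplifier can
  execute the program forwards.\<close>

lemma funpow_numeral_right: "(f ^^ numeral k) s = (f ^^ pred_numeral k) (f s)"
  by (simp add: numeral_eq_Suc funpow_swap1)

text \<open>The three cells of a column \<open>j > 0\<close> have negative addresses, apart from the
  input at nonnegative ones, and 0 is left as the null pointer.\<close>

definition ptr :: "nat \<Rightarrow> int" where
  "ptr j = - 3 * int j"

lemma ptr_eq_iff [simp]: "ptr i = ptr j \<longleftrightarrow> i = j"
  by (simp add: ptr_def)

lemma ptr_cells_disjoint [simp]:
  "ptr i + 1 \<noteq> ptr j" "ptr i + 2 \<noteq> ptr j" "ptr i + 1 \<noteq> ptr j + 2" "ptr i + 2 \<noteq> ptr j + 1"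
  "ptr j \<noteq> ptr i + 1" "ptr j \<noteq> ptr i + 2"
  unfolding ptr_def by presburger+

text \<open>A null-terminated linked list, used for the columns seen so far.\<close>

fun chain :: "(int \<Rightarrow> int) \<Rightarrow> int \<Rightarrow> int list \<Rightarrow> bool" where
  "chain M a [] \<longleftrightarrow> a = 0"
| "chain M a (d # ds) \<longleftrightarrow> a = d \<and> d \<noteq> 0 \<and> chain M (M (d + 2)) ds"

lemma chain_cong: "(\<And>d. d \<in> set ds \<Longrightarrow> M' (d + 2) = M (d + 2)) \<Longrightarrow> chain M' a ds = chain M a ds"
  by (induction ds arbitrary: a) auto

section \<open>Colourings encoded by labels and marks\<close>

text \<open>
  The colourings of row \<open>i\<close> and the columns that extend to a colouring constant along \<open>D\<close> are those
  that are constant on equal labels \<open>L\<close> and agree with row \<open>i\<close> on the labels in \<open>S\<close>.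
\<close>

definition represents :: "index set \<Rightarrow> nat \<Rightarrow> (nat \<Rightarrow> int) \<Rightarrow> int set \<Rightarrow> bool" where
  "represents D i L S \<longleftrightarrow>
     (\<forall>y c. (\<exists>x. x i = c \<and> (\<forall>(k, l)\<in>D. x k = y l)) \<longleftrightarrow>
        (\<forall>j j'. L j = L j' \<longrightarrow> y j = y j') \<and> (\<forall>j. L j \<in> S \<longrightarrow> y j = (c :: bool)))"

lemma represents_empty: "inj L \<Longrightarrow> represents {} i L {}"
  by (auto simp: represents_def dest: injD)

lemma represents_closes_cycle:
  assumes "represents D i L S"
  shows "closes_cycle D (i, j) \<longleftrightarrow> L j \<in> S"
proof
  assume "L j \<in> S"
  show "closes_cycle D (i, j)"
    unfolding closes_cycle_def
  proof (intro allI impI)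
    fix x y :: "nat \<Rightarrow> bool" assume "\<forall>(k, l)\<in>D. x k = y l"
    then have "\<forall>j. L j \<in> S \<longrightarrow> y j = x i"
      using assms[unfolded represents_def, rule_format, of "x i" y] by blast
    then show "x (fst (i, j)) = y (snd (i, j))" using \<open>L j \<in> S\<close> by simp
  qed
next
  assume cyc: "closes_cycle D (i, j)"
  \<comment> \<open>Colouring the columns by membership in \<open>S\<close> is consistent with
    colour \<open>True\<close> for row \<open>i\<close>, hence extends to all rows. A closed cycle
    then forces column \<open>j\<close> to be \<open>True\<close> as well.\<close>
  obtain x where x: "x i = True" "\<forall>(k, l)\<in>D. x k = (L l \<in> S)"
    using assms[unfolded represents_def, rule_format, of True "\<lambda>l. L l \<in> S"] by auto
  then show "L j \<in> S"
    using cyc[unfolded closes_cycle_def, rule_format, of x "\<lambda>l. L l \<in> S"] by simp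
qed

lemma represents_insert:
  assumes "represents D i L S"
  shows "represents (insert (i, j) D) i L (insert (L j) S)"
  unfolding represents_def
proof (intro allI)
  fix y and c :: bool
  have "(\<exists>x. x i = c \<and> (\<forall>(k, l)\<in>insert (i, j) D. x k = y l)) \<longleftrightarrow>
      (\<exists>x. x i = c \<and> (\<forall>(k, l)\<in>D. x k = y l)) \<and> y j = c" by auto
  also have "\<dots> \<longleftrightarrow> (\<forall>j j'. L j = L j' \<longrightarrow> y j = y j') \<and> (\<forall>j. L j \<in> S \<longrightarrow> y j = c) \<and> y j = c"
    unfolding assms[unfolded represents_def, rule_format, of c y] by blast
  also have "\<dots> \<longleftrightarrow> (\<forall>j j'. L j = L j' \<longrightarrow> y j = y j') \<and> (\<forall>j'. L j' \<in> insert (L j) S \<longrightarrow> y j' = c)"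
    by auto
  finally show "(\<exists>x. x i = c \<and> (\<forall>(k, l)\<in>insert (i, j) D. x k = y l)) \<longleftrightarrow>
      (\<forall>j j'. L j = L j' \<longrightarrow> y j = y j') \<and> (\<forall>j'. L j' \<in> insert (L j) S \<longrightarrow> y j' = c)" .
qed

text \<open>The new row has no edge, so its colour is free. The old row's colour becomes
  existential: columns with labels in \<open>S\<close> need only agree with each other, which merges
  these labels. Taking \<open>r\<close> from \<open>S\<close> keeps the merged label apart from
  those outside \<open>S\<close>.\<close>

lemma represents_new_row:
  assumes "represents D i L S" "i' \<notin> fst ` D" "S \<noteq> {} \<Longrightarrow> r \<in> S"
  shows "represents D i' (\<lambda>j. if L j \<in> S then r else L j) {}"
  unfolding represents_def
proof (intro allI)
  fix y and c :: bool
  let ?L = "\<lambda>j. if L j \<in> S then r else L j"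
  have "(\<exists>x. x i' = c \<and> (\<forall>(k, l)\<in>D. x k = y l)) \<longleftrightarrow> (\<exists>x. \<forall>(k, l)\<in>D. x k = y l)"
  proof
    assume "\<exists>x. \<forall>(k, l)\<in>D. x k = y l"
    then obtain x where x: "\<forall>(k, l)\<in>D. x k = y l" by blast
    then have "\<forall>(k, l)\<in>D. (x(i' := c)) k = y l" using assms(2) by force
    then show "\<exists>x. x i' = c \<and> (\<forall>(k, l)\<in>D. x k = y l)" by (intro exI[of _ "x(i' := c)"]) simp
  qed blast
  also have "\<dots> \<longleftrightarrow> (\<exists>c x. x i = c \<and> (\<forall>(k, l)\<in>D. x k = y l))" by simp
  also have "\<dots> \<longleftrightarrow> (\<exists>c. (\<forall>j j'. L j = L j' \<longrightarrow> y j = y j') \<and> (\<forall>j. L j \<in> S \<longrightarrow> y j = c))"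
    using assms(1) unfolding represents_def by simp
  also have "\<dots> \<longleftrightarrow> (\<forall>j j'. ?L j = ?L j' \<longrightarrow> y j = y j')"
  proof
    assume "\<exists>c. (\<forall>j j'. L j = L j' \<longrightarrow> y j = y j') \<and> (\<forall>j. L j \<in> S \<longrightarrow> y j = c)"
    then obtain c where c: "\<And>j j'. L j = L j' \<Longrightarrow> y j = y j'" "\<And>j. L j \<in> S \<Longrightarrow> y j = c" by blast
    show "\<forall>j j'. ?L j = ?L j' \<longrightarrow> y j = y j'"
    proof (intro allI impI)
      fix j j' assume eq: "?L j = ?L j'"
      then have "L j \<in> S \<longleftrightarrow> L j' \<in> S" using assms(3) by (auto split: if_splits)
      then show "y j = y j'"
      proof (cases "L j \<in> S")
        case True
        then show ?thesis using c(2)[of j] c(2)[of j'] \<open>L j \<in> S \<longleftrightarrow> L j' \<in> S\<close> by simp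
      next
        case False
        then show ?thesis using c(1)[of j j'] \<open>L j \<in> S \<longleftrightarrow> L j' \<in> S\<close> eq by simp
      qed
    qed
  next
    assume *: "\<forall>j j'. ?L j = ?L j' \<longrightarrow> y j = y j'"
    have 1: "y j = y j'" if "L j = L j'" for j j' using * that by metis
    have 2: "y j = y j'" if "L j \<in> S" "L j' \<in> S" for j j' using that * by simp
    show "\<exists>c. (\<forall>j j'. L j = L j' \<longrightarrow> y j = y j') \<and> (\<forall>j. L j \<in> S \<longrightarrow> y j = c)"
    proof (intro exI conjI allI impI)
      \<comment> \<open>The old row takes the colour of some column labelled in \<open>S\<close>; if
        there is none, the arbitrary choice is harmless.\<close>
      fix j assume "L j \<in> S"
      then show "y j = y (SOME j. L j \<in> S)" by (rule 2) (rule someI, fact)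
    qed (rule 1)
  qed
  finally show "(\<exists>x. x i' = c \<and> (\<forall>(k, l)\<in>D. x k = y l)) \<longleftrightarrow>
      (\<forall>j j'. ?L j = ?L j' \<longrightarrow> y j = y j') \<and> (\<forall>j. ?L j \<in> {} \<longrightarrow> y j = c)" by simp
qed

text \<open>An unseen column counts as labelled by its own pointer. The labelling is thus injective
  at the start without any initialisation of memory.\<close>

definition label :: "int list \<Rightarrow> (int \<Rightarrow> int) \<Rightarrow> nat \<Rightarrow> int" where
  "label cs M j = (if ptr j \<in> set cs then M (ptr j) else ptr j)"

text \<open>Marks are row numbers rather than bits, so they expire by themselves when the row
  changes.\<close>

definition marked :: "int list \<Rightarrow> (int \<Rightarrow> int) \<Rightarrow> nat \<Rightarrow> int set" where
  "marked cs M i = {l \<in> set cs. M (l + 1) = int i}"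

text \<open>The bounds by \<open>i\<close> on marks and on the rows of \<open>D\<close> ensure that
  a later row finds no mark of its own and has no edge yet.\<close>

definition invariant ::
  "int list \<Rightarrow> nat \<Rightarrow> index set \<Rightarrow> (nat \<Rightarrow> int) \<Rightarrow> (int \<Rightarrow> int) \<Rightarrow> bool" where
  "invariant cs i D R M \<longleftrightarrow>
     R 3 = 1 \<and> R 15 = 0 \<and> R 6 = int i \<and> (marked cs M i \<noteq> {} \<longrightarrow> R 10 \<in> marked cs M i) \<and>
     chain M (R 11) cs \<and> distinct cs \<and> set cs \<subseteq> ptr ` {0<..} \<and>
     (\<forall>j>0. ptr j \<notin> set cs \<longrightarrow> M (ptr j) = 0 \<and> M (ptr j + 1) = 0) \<and>
     (\<forall>a\<in>set cs. M a \<in> set cs \<and> M (a + 1) \<le> int i) \<and>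
     fst ` D \<subseteq> {..i} \<and> represents D i (label cs M) (marked cs M i)"

section \<open>Symbolic execution of the program\<close>

context
  fixes I :: "index set" and B :: "index \<Rightarrow> int"
begin

definition run :: "nat \<Rightarrow> ram_state \<Rightarrow> ram_state" where
  "run k s = (step (ram forest_program) I B ^^ k) s"

lemma run_add: "run (k + l) s = run l (run k s)"
  by (simp add: run_def add.commute[of k l] funpow_add)

lemma run_numeral: "run (numeral k) s = run (pred_numeral k) (run 1 s)"
  by (simp add: run_def funpow_numeral_right)

lemma run_0: "run 0 s = s"
  by (simp add: run_def)

lemma run_Suc_0: "run (Suc 0) s = step (ram forest_program) I B s"
  by (simp add: run_def)

lemmas run_simps = run_numeral run_0 run_Suc_0 step_ram forest_program_def

lemma run_load_entry:
  assumes "R 3 = 1" "R 1 \<noteq> 0" "M (R 2) = int i" "M (R 2 + 1) = int j" "(i, j) \<in> I"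
  shows "\<exists>R'. run 7 (1, R, M) = (8, R', M) \<and> R' 1 = R 1 - 1 \<and> R' 2 = R 2 + 2 \<and>
    R' 4 = int i \<and> R' 5 = int j \<and> R' 7 = B (i, j) \<and> (\<forall>r. r \<notin> {1, 2, 4, 5, 7} \<longrightarrow> R' r = R r)"
  using assms by (simp add: run_simps)

text \<open>Only label cells, at multiples of 3, are overwritten; the marks and links read later are
  not. The sequential pass therefore acts as a simultaneous relabelling. Either branch of the loop
  takes 11 steps, and one more leaves it.\<close>

lemma run_relabel:
  assumes "chain M (R 12) ds" "distinct ds" "R 3 = 1" "\<And>a. a \<in> set ds \<Longrightarrow> 3 dvd a \<and> 3 dvd M a"
  shows "\<exists>R'. run (11 * length ds + 1) (11, R, M) =
      (23, R', \<lambda>a. if a \<in> set ds \<and> M (M a + 1) = R 6 then R 10 else M a) \<and>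
      (\<forall>r. r \<notin> {8, 9, 12, 13} \<longrightarrow> R' r = R r)"
  using assms
proof (induction ds arbitrary: R M)
  case Nil
  then show ?case by (simp add: run_simps)
next
  case (Cons a ds)
  define M1 where "M1 = (if M (M a + 1) = R 6 then M(a := R 10) else M)"
  have a: "R 12 = a" "a \<noteq> 0" "3 dvd a" "a \<notin> set ds" "3 dvd M a" using Cons.prems by auto
  have neq: "b + 1 \<noteq> a" "b + 2 \<noteq> a" if "3 dvd b" for b using that a(3) by presburger+
  have M1: "M1 b = M b" if "b \<noteq> a" for b using that by (simp add: M1_def)
  have "\<exists>R1. run 11 (11, R, M) = (11, R1, M1) \<and> R1 12 = M1 (a + 2) \<and>
      (\<forall>r. r \<notin> {8, 9, 12, 13} \<longrightarrow> R1 r = R r)"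
    using a(1,2) Cons.prems(3) by (cases "M (M a + 1) = R 6") (simp_all add: run_simps M1_def add.commute[of 2])
  then obtain R1 where R1: "run 11 (11, R, M) = (11, R1, M1)" "R1 12 = M1 (a + 2)"
    "\<And>r. r \<notin> {8, 9, 12, 13} \<Longrightarrow> R1 r = R r" by blast
  have "chain M1 (R1 12) ds = chain M (M (a + 2)) ds"
    using neq a(3) Cons.prems(4) by (subst chain_cong[of ds M1 M]) (auto simp: M1 R1(2))
  then have chain: "chain M1 (R1 12) ds" using Cons.prems(1) by simp
  have dvd: "3 dvd b \<and> 3 dvd M1 b" if "b \<in> set ds" for b
  proof -
    have "b \<noteq> a" using that a(4) by blast
    then show ?thesis using that M1[of b] Cons.prems(4)[of b] by simp
  qed
  have "distinct ds" "R1 3 = 1" using Cons.prems(2,3) R1(3) by simp_all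
  then obtain R' where R': "run (11 * length ds + 1) (11, R1, M1) =
      (23, R', \<lambda>b. if b \<in> set ds \<and> M1 (M1 b + 1) = R1 6 then R1 10 else M1 b)"
    "\<And>r. r \<notin> {8, 9, 12, 13} \<Longrightarrow> R' r = R1 r"
    using Cons.IH[of M1 R1] chain dvd by blast
  have "(\<lambda>b. if b \<in> set ds \<and> M1 (M1 b + 1) = R1 6 then R1 10 else M1 b) =
      (\<lambda>b. if b \<in> set (a # ds) \<and> M (M b + 1) = R 6 then R 10 else M b)"
  proof
    fix b
    show "(if b \<in> set ds \<and> M1 (M1 b + 1) = R1 6 then R1 10 else M1 b) =
      (if b \<in> set (a # ds) \<and> M (M b + 1) = R 6 then R 10 else M b)"
    proof (cases "b \<in> set ds")
      case True
      then have "M1 b = M b" "M1 (M b + 1) = M (M b + 1)"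
        using a(4) M1[of b] M1[of "M b + 1"] neq(1)[of "M b"] Cons.prems(4)[of b] by auto
      then show ?thesis using True R1(3) by simp
    next
      case False
      then show ?thesis by (auto simp: M1_def)
    qed
  qed
  moreover have "run (11 * length (a # ds) + 1) (11, R, M) = run (11 * length ds + 1) (11, R1, M1)"
    using run_add[of 11 "11 * length ds + 1" "(11, R, M)"] R1(1) by (simp add: algebra_simps)
  ultimately show ?case using R' R1(3) by auto
qed

text \<open>Only a change of row pays for a pass over the seen columns; this yields a product of
  rows and columns in the time bound.\<close>

lemma run_set_row:
  assumes inv: "invariant cs i D R M" and "R 4 = int i'" "i \<le> i'"
  shows "\<exists>k R' M'. run k (8, R, M) = (24, R', M') \<and> invariant cs i' D R' M' \<and>
    (\<forall>a\<ge>0. M' a = M a) \<and> (\<forall>r\<in>{1, 2, 5, 7}. R' r = R r) \<and>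
    k \<le> 5 + (if i' = i then 0 else 11 * length cs)"
proof (cases "i' = i")
  case True
  have "run 2 (8, R, M) = (24, R(9 := 0), M)"
    using True assms by (simp add: run_simps invariant_def)
  moreover have "invariant cs i' D (R(9 := 0)) M" using inv True by (simp add: invariant_def)
  ultimately show ?thesis using True by (intro exI[of _ 2] exI[of _ "R(9 := 0)"] exI[of _ M]) simp
next
  case False
  have R: "R 3 = 1" "R 15 = 0" "R 6 = int i" "chain M (R 11) cs" "distinct cs"
    "marked cs M i \<noteq> {} \<Longrightarrow> R 10 \<in> marked cs M i"
    and cs: "set cs \<subseteq> ptr ` {0<..}"
    and fresh: "\<And>j. j > 0 \<Longrightarrow> ptr j \<notin> set cs \<Longrightarrow> M (ptr j) = 0 \<and> M (ptr j + 1) = 0"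
    and old: "\<And>a. a \<in> set cs \<Longrightarrow> M a \<in> set cs \<and> M (a + 1) \<le> int i"
    and D: "fst ` D \<subseteq> {..i}" and rep: "represents D i (label cs M) (marked cs M i)"
    using inv unfolding invariant_def by auto
  have dvd: "3 dvd a" if "a \<in> set cs" for a using cs that by (auto simp: ptr_def)
  define R1 where "R1 = R(9 := int i' - int i, 12 := R 11)"
  have run1: "run 3 (8, R, M) = (11, R1, M)"
    using assms(2) False R(2,3) by (simp add: run_simps R1_def fun_upd_twist)
  define M' where "M' = (\<lambda>a. if a \<in> set cs \<and> M (M a + 1) = R 6 then R 10 else M a)"
  have "\<exists>R'. run (11 * length cs + 1) (11, R1, M) =
      (23, R', \<lambda>a. if a \<in> set cs \<and> M (M a + 1) = R1 6 then R1 10 else M a) \<and>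
      (\<forall>r. r \<notin> {8, 9, 12, 13} \<longrightarrow> R' r = R1 r)"
    by (rule run_relabel) (use R old dvd in \<open>auto simp: R1_def\<close>)
  then obtain R2 where run2': "run (11 * length cs + 1) (11, R1, M) =
      (23, R2, \<lambda>a. if a \<in> set cs \<and> M (M a + 1) = R1 6 then R1 10 else M a)"
    and "\<forall>r. r \<notin> {8, 9, 12, 13} \<longrightarrow> R2 r = R1 r" by blast
  have M'_eq: "M' = (\<lambda>a. if a \<in> set cs \<and> M (M a + 1) = R1 6 then R1 10 else M a)"
    by (simp add: M'_def R1_def cong: if_cong)
  note run2 = run2'[folded M'_eq]
  from \<open>\<forall>r. r \<notin> {8, 9, 12, 13} \<longrightarrow> R2 r = R1 r\<close> have R2: "\<And>r. r \<notin> {8, 9, 12, 13} \<Longrightarrow> R2 r = R r" by (simp add: R1_def)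
  have run3: "run 1 (23, R2, M') = (24, R2(6 := int i'), M')"
    using R2[of 4] R2[of 15] R(2) assms(2) by (simp add: run_simps)
  have "run (3 + (11 * length cs + 1) + 1) (8, R, M) = (24, R2(6 := int i'), M')"
    by (simp only: run_add[of "3 + (11 * length cs + 1)" 1] run_add[of 3] run1 run2 run3)
  moreover have "invariant cs i' D (R2(6 := int i')) M'"
  proof -
    have M'_off: "M' a = M a" if "a \<notin> set cs" for a using that by (simp add: M'_def)
    have off: "a + 1 \<notin> set cs" "a + 2 \<notin> set cs" if "3 dvd a" for a
    proof -
      have "\<not> 3 dvd a + 1" "\<not> 3 dvd a + 2" using that by presburger+
      then show "a + 1 \<notin> set cs" "a + 2 \<notin> set cs" using dvd by blast+
    qed
    have mark: "M' (a + 1) = M (a + 1)" if "a \<in> set cs" for a using M'_off off dvd[OF that] by simp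
    have "\<not> M' (a + 1) = int i'" if "a \<in> set cs" for a
      using mark[OF that] old[OF that] False assms(3) by simp
    then have marked: "marked cs M' i' = {}" by (auto simp: marked_def)
    \<comment> \<open>This is the merged labelling of \<open>represents_new_row\<close>, with
      register 10 supplying the label \<open>r\<close>.\<close>
    have "label cs M' = (\<lambda>j. if label cs M j \<in> marked cs M i then R 10 else label cs M j)"
      using old R(3) by (auto simp: label_def marked_def M'_def fun_eq_iff)
    moreover have "i' \<notin> fst ` D" using D False assms(3) by auto
    ultimately have "represents D i' (label cs M') (marked cs M' i')"
      using represents_new_row[OF rep _ R(6)] marked by simp
    moreover have "chain M' (R 11) cs"
      using R(4) chain_cong[of cs M' M] M'_off off dvd by simp
    moreover have "M' (ptr j) = 0 \<and> M' (ptr j + 1) = 0" if "j > 0" "ptr j \<notin> set cs" for j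
      using fresh[OF that] M'_off that(2) off(1)[of "ptr j"] by (simp add: ptr_def)
    moreover have "M' a \<in> set cs \<and> M' (a + 1) \<le> int i'" if "a \<in> set cs" for a
    proof -
      have "R 10 \<in> set cs" if "M (M a + 1) = R 6"
        using that R(3,6) old[OF \<open>a \<in> set cs\<close>] by (auto simp: marked_def)
      then show ?thesis using mark[OF that] old[OF that] assms(3) by (auto simp: M'_def)
    qed
    moreover have "fst ` D \<subseteq> {..i'}" using D assms(3) by auto
    ultimately show ?thesis unfolding invariant_def using R(1,2,5) R2 cs marked by simp
  qed
  moreover have "M' a = M a" if "a \<ge> 0" for a
    using that cs by (auto simp: M'_def ptr_def)
  ultimately show ?thesis using False R2
    by (intro exI[of _ "3 + (11 * length cs + 1) + 1"] exI[of _ "R2(6 := int i')"] exI[of _ M']) simp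
qed

text \<open>A new column receives as label the pointer it had implicitly, so \<open>label\<close> is
  unchanged. Its mark cell still holds 0, which is no current row because
  \<open>i > 0\<close>.\<close>

lemma run_set_column:
  assumes inv: "invariant cs i D R M" and R5: "R 5 = int j" and pos: "i > 0" "j > 0"
  shows "\<exists>k R' M' cs'. run k (24, R, M) = (36, R', M') \<and> invariant cs' i D R' M' \<and>
    set cs' = insert (ptr j) (set cs) \<and> R' 8 = M' (ptr j) \<and>
    (\<forall>a\<ge>0. M' a = M a) \<and> (\<forall>r\<in>{1, 2, 7}. R' r = R r) \<and> k \<le> 11"
proof -
  have R: "R 3 = 1" "R 15 = 0" "R 6 = int i" "chain M (R 11) cs" "distinct cs"
    "marked cs M i \<noteq> {} \<Longrightarrow> R 10 \<in> marked cs M i"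
    and cs: "set cs \<subseteq> ptr ` {0<..}"
    and fresh: "\<And>j. j > 0 \<Longrightarrow> ptr j \<notin> set cs \<Longrightarrow> M (ptr j) = 0 \<and> M (ptr j + 1) = 0"
    and old: "\<And>a. a \<in> set cs \<Longrightarrow> M a \<in> set cs \<and> M (a + 1) \<le> int i"
    and D: "fst ` D \<subseteq> {..i}" and rep: "represents D i (label cs M) (marked cs M i)"
    using inv unfolding invariant_def by auto
  define a where "a = ptr j"
  have a: "- int j - int j - int j = a" "a < 0" using pos by (auto simp: a_def ptr_def)
  show ?thesis
  proof (cases "a \<in> set cs")
    case True
    then have "M a \<noteq> 0" using old[of a] cs by (auto simp: ptr_def)
    then have "run 6 (24, R, M) = (36, R(9 := a, 8 := M a), M)"
      using R(2) R5 a by (simp add: run_simps)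
    moreover have "invariant cs i D (R(9 := a, 8 := M a)) M" using inv by (simp add: invariant_def)
    ultimately show ?thesis using True a_def
      by (intro exI[of _ 6] exI[of _ "R(9 := a, 8 := M a)"] exI[of _ M] exI[of _ cs]) auto
  next
    case False
    then have Ma: "M a = 0" "M (a + 1) = 0" using fresh[of j] pos by (auto simp: a_def)
    define M' where "M' = M(a := a, a + 2 := R 11)"
    define R' where "R' = R(9 := a, 8 := a, 12 := a + 2, 11 := a)"
    have "run 11 (24, R, M) = (36, R', M')"
      using R(1,2) R5 a Ma by (simp add: run_simps M'_def R'_def fun_upd_twist add.commute[of 2])
    moreover have "invariant (a # cs) i D R' M'"
    proof -
      have M'_ptr: "M' (ptr k) = (if k = j then a else M (ptr k))" "M' (ptr k + 1) = M (ptr k + 1)" for k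
        by (simp_all add: M'_def a_def)
      have M'_cs: "M' b = M b" "M' (b + 1) = M (b + 1)" "M' (b + 2) = M (b + 2)" if b: "b \<in> set cs" for b
      proof -
        obtain k where "b = ptr k" "k \<noteq> j" using b cs False by (auto simp: a_def)
        then show "M' b = M b" "M' (b + 1) = M (b + 1)" "M' (b + 2) = M (b + 2)"
          by (simp_all add: M'_def a_def)
      qed
      have label: "label (a # cs) M' = label cs M"
        using False by (auto simp: label_def M'_ptr a_def fun_eq_iff)
      have "M' (a + 1) = 0" using Ma(2) by (simp add: M'_def)
      then have marked: "marked (a # cs) M' i = marked cs M i"
        using pos(1) M'_cs(2) by (auto simp: marked_def)
      have "chain M' (R 11) cs" using R(4) chain_cong[of cs M' M] M'_cs(3) by simp
      then have "chain M' a (a # cs)" using a(2) by (simp add: M'_def)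
      moreover have "M' (ptr k) = 0 \<and> M' (ptr k + 1) = 0" if "k > 0" "ptr k \<notin> set (a # cs)" for k
        using fresh[OF that(1)] that(2) M'_ptr by (auto simp: a_def)
      moreover have "M' b \<in> set (a # cs) \<and> M' (b + 1) \<le> int i" if "b \<in> set (a # cs)" for b
      proof (cases "b \<in> set cs")
        case True
        then show ?thesis using M'_cs old by simp
      next
        case False
        then show ?thesis using that \<open>M' (a + 1) = 0\<close> by (simp add: M'_def)
      qed
      ultimately show ?thesis
        unfolding invariant_def label marked
        using R(1,2,3,5,6) cs False D rep pos by (simp add: R'_def a_def)
    qed
    ultimately show ?thesis using a
      by (intro exI[of _ 11] exI[of _ R'] exI[of _ M'] exI[of _ "a # cs"])
        (auto simp: M'_def R'_def a_def[symmetric])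
  qed
qed

text \<open>The mark of the label of column \<open>j\<close> tells whether that label is tied to row
  \<open>i\<close>, which is the cycle test. Otherwise setting the mark performs
  \<open>represents_insert\<close>.\<close>

lemma run_edge:
  assumes inv: "invariant cs i D R M" and j: "ptr j \<in> set cs" and R8: "R 8 = M (ptr j)"
    and R7: "R 7 \<noteq> 0"
  shows "closes_cycle D (i, j) \<Longrightarrow> \<exists>R'. run 5 (36, R, M) = (44, R', M)"
    and "\<not> closes_cycle D (i, j) \<Longrightarrow> \<exists>R' M'. run 8 (36, R, M) = (1, R', M') \<and>
      invariant cs i (insert (i, j) D) R' M' \<and> (\<forall>a\<ge>0. M' a = M a) \<and> (\<forall>r\<in>{1, 2}. R' r = R r)"
proof -
  have R: "R 3 = 1" "R 15 = 0" "R 6 = int i" "chain M (R 11) cs" "distinct cs"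
    and cs: "set cs \<subseteq> ptr ` {0<..}"
    and fresh: "\<And>j. j > 0 \<Longrightarrow> ptr j \<notin> set cs \<Longrightarrow> M (ptr j) = 0 \<and> M (ptr j + 1) = 0"
    and old: "\<And>a. a \<in> set cs \<Longrightarrow> M a \<in> set cs \<and> M (a + 1) \<le> int i"
    and D: "fst ` D \<subseteq> {..i}" and rep: "represents D i (label cs M) (marked cs M i)"
    using inv unfolding invariant_def by auto
  define l where "l = M (ptr j)"
  have l: "l \<in> set cs" "label cs M j = l" using old j by (auto simp: l_def label_def)
  have cyc: "closes_cycle D (i, j) \<longleftrightarrow> M (l + 1) = int i"
    using represents_closes_cycle[OF rep] l by (simp add: marked_def)
  show "\<exists>R'. run 5 (36, R, M) = (44, R', M)" if "closes_cycle D (i, j)"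
    using that[unfolded cyc] R(1,3) R7 R8 by (simp add: run_simps l_def)
  assume "\<not> closes_cycle D (i, j)"
  then have unmarked: "M (l + 1) \<noteq> int i" using cyc by simp
  define M' where "M' = M(l + 1 := int i)"
  define R' where "R' = R(13 := l + 1, 12 := M (l + 1) - int i, 10 := l)"
  have "run 8 (36, R, M) = (1, R', M')"
    using unmarked R(1,2,3) R7 R8 by (simp add: run_simps M'_def R'_def l_def fun_upd_twist)
  moreover have "invariant cs i (insert (i, j) D) R' M'"
  proof -
    obtain k where k: "l = ptr k" using l cs by auto
    have M': "M' (ptr b) = M (ptr b)" "M' (ptr b + 2) = M (ptr b + 2)" for b
      by (simp_all add: M'_def k)
    have M'_cs: "M' b = M b" "M' (b + 2) = M (b + 2)" if "b \<in> set cs" for b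
      using that cs M' by auto
    have marked: "marked cs M' i = insert l (marked cs M i)"
      using l by (auto simp: marked_def M'_def)
    have label: "label cs M' = label cs M" using M' by (auto simp: label_def fun_eq_iff)
    have "chain M' (R 11) cs" using R(4) chain_cong[of cs M' M] M'_cs(2) by simp
    moreover have "M' (ptr b) = 0 \<and> M' (ptr b + 1) = 0" if "b > 0" "ptr b \<notin> set cs" for b
      using fresh[OF that] that(2) l k M' by (auto simp: M'_def)
    moreover have "M' b \<in> set cs \<and> M' (b + 1) \<le> int i" if "b \<in> set cs" for b
      using old[OF that] M'_cs[OF that] by (auto simp: M'_def)
    ultimately show ?thesis
      unfolding invariant_def label marked
      using R cs D represents_insert[OF rep, of j] l by (auto simp: R'_def)
  qed
  moreover have "M' a = M a" if "a \<ge> 0" for a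
    using that l cs by (auto simp: M'_def ptr_def)
  ultimately show "\<exists>R' M'. run 8 (36, R, M) = (1, R', M') \<and>
      invariant cs i (insert (i, j) D) R' M' \<and> (\<forall>a\<ge>0. M' a = M a) \<and> (\<forall>r\<in>{1, 2}. R' r = R r)"
    by (intro exI[of _ R'] exI[of _ M']) (simp add: R'_def)
qed

lemma run_no_edge:
  "R 7 = 0 \<Longrightarrow> run 1 (36, R, M) = (1, R, M)"
  by (simp add: run_simps)

text \<open>An entry costs at most 7 + 5 + 11 + 8 = 31 steps besides merging. Each row still to be
  started costs one pass, 11 steps per seen column; \<open>i\<close> is removed because it has
  already been started.\<close>

lemma run_forest_program:
  assumes "row_major I = us @ vs" "sorted (i # map fst vs)" "I \<subseteq> grid n"
    and "invariant cs i D R M" "set cs = ptr ` snd ` set us"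
    and "R 1 = int (length vs)" "R 2 = 2 * int (length us)"
    and "\<And>a. a \<ge> 0 \<Longrightarrow> M a = snd (snd (ram_start n I)) a"
  shows "\<exists>k. action (ram forest_program) (run k (1, R, M)) = Answer (acyclic_from B D vs) \<and>
    k \<le> 31 * length vs + 11 * card (snd ` I) * card (fst ` set vs - {i}) + 1"
  using assms
proof (induction vs arbitrary: us i cs D R M)
  case Nil
  then have "run 1 (1, R, M) = (45, R, M)" by (simp add: run_simps)
  then show ?case
    by (intro exI[of _ 1]) (simp add: ram_def ram_action_def forest_program_def)
next
  case (Cons e vs)
  obtain i' j where e: "e = (i', j)" by (cases e)
  have finite_I: "finite I" using finite_subset[OF Cons.prems(3)] by (simp add: grid_def)
  have set_es: "set (us @ e # vs) = I" using set_row_major[OF finite_I] Cons.prems(1) by simp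
  then have eI: "(i', j) \<in> I" using e by auto
  then have pos: "i' > 0" "j > 0" using Cons.prems(3) by (auto simp: grid_def)
  have ii': "i \<le> i'" using Cons.prems(2) e by simp
  have nth: "row_major I ! length us = (i', j)" using Cons.prems(1) e by simp
  have len: "length us < length (row_major I)" using Cons.prems(1) by simp
  have M: "M (R 2) = int i'" "M (R 2 + 1) = int j"
  proof -
    have "nat (2 * int (length us)) = 2 * length us" "nat (2 * int (length us) + 1) = 2 * length us + 1"
      by auto
    then show "M (R 2) = int i'" "M (R 2 + 1) = int j"
      using Cons.prems(7,8) nth_input_word[OF len] nth len
      by (auto simp: ram_start_def length_input_word)
  qed
  have R3: "R 3 = 1" using Cons.prems(4) by (simp add: invariant_def)
  obtain R1 where R1: "run 7 (1, R, M) = (8, R1, M)" "R1 1 = R 1 - 1" "R1 2 = R 2 + 2"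
    "R1 4 = int i'" "R1 5 = int j" "R1 7 = B (i', j)" "\<forall>r. r \<notin> {1, 2, 4, 5, 7} \<longrightarrow> R1 r = R r"
    using run_load_entry[OF R3 _ M eI] Cons.prems(6) by auto
  have "invariant cs i D R1 M" using Cons.prems(4) R1(7) by (simp add: invariant_def)
  from run_set_row[OF this R1(4) ii'] obtain k2 R2 M2 where
    2: "run k2 (8, R1, M) = (24, R2, M2)" "invariant cs i' D R2 M2" "\<forall>a\<ge>0. M2 a = M a"
    "\<forall>r\<in>{1, 2, 5, 7}. R2 r = R1 r" "k2 \<le> 5 + (if i' = i then 0 else 11 * length cs)" by blast
  have "R2 5 = int j" using 2(4) R1(5) by simp
  from run_set_column[OF 2(2) this pos] obtain k3 R3 M3 cs' where
    3: "run k3 (24, R2, M2) = (36, R3, M3)" "invariant cs' i' D R3 M3"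
    "set cs' = insert (ptr j) (set cs)" "R3 8 = M3 (ptr j)" "\<forall>a\<ge>0. M3 a = M2 a"
    "\<forall>r\<in>{1, 2, 7}. R3 r = R2 r" "k3 \<le> 11" by blast
  have run3: "run (7 + k2 + k3) (1, R, M) = (36, R3, M3)"
    by (simp only: run_add R1(1) 2(1) 3(1))
  have R3_7: "R3 7 = B (i', j)" using 3(6) 2(4) R1(6) by simp
  have R3_12: "R3 1 = R 1 - 1" "R3 2 = R 2 + 2" using 3(6) 2(4) R1(2,3) by simp_all
  have M3: "M3 a = M a" if "a \<ge> 0" for a using 3(5) 2(3) that by simp
  have ptr_j: "ptr j \<in> set cs'" using 3(3) by simp
  have "length cs = card (set cs)"
    using Cons.prems(4) by (simp add: invariant_def distinct_card)
  also have "\<dots> \<le> card (snd ` set us)" unfolding Cons.prems(5) by (rule card_image_le) simp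
  also have "\<dots> \<le> card (snd ` I)" by (rule card_mono) (use finite_I set_es in auto)
  finally have length_cs: "length cs \<le> card (snd ` I)" .
  define c where "c = card (snd ` I)"
  have budget: "7 + k2 + k3 + 8 + (31 * length vs + 11 * c * card (fst ` set vs - {i'}) + 1) \<le>
      31 * length (e # vs) + 11 * c * card (fst ` set (e # vs) - {i}) + 1"
  proof (cases "i' = i")
    case True
    then show ?thesis using 2(5) 3(7) e by simp
  next
    case False
    \<comment> \<open>By sortedness the old row \<open>i\<close> does not recur, so starting
      \<open>i'\<close> uses up exactly one pending row, which pays for the pass.\<close>
    then have "fst ` set (e # vs) - {i} = insert i' (fst ` set vs - {i'})"
      using Cons.prems(2) e by auto
    then have "card (fst ` set (e # vs) - {i}) = Suc (card (fst ` set vs - {i'}))"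
      by (simp only:) (rule card_insert_disjoint, simp_all)
    then show ?thesis using 2(5) 3(7) False length_cs by (simp add: c_def)
  qed
  \<comment> \<open>The common continuation after a zero entry (\<open>D'\<close> is
    \<open>D\<close>) and after an accepted edge (\<open>D'\<close> has one more edge).\<close>
  have next_entry: ?case
    if run': "run k4 (36, R3, M3) = (1, R', M')" and k4: "k4 \<le> 8"
      and inv': "invariant cs' i' D' R' M'" and M': "\<forall>a\<ge>0. M' a = M3 a"
      and R': "\<forall>r\<in>{1, 2}. R' r = R3 r"
      and acyc: "acyclic_from B D (e # vs) = acyclic_from B D' vs" for k4 R' M' D'
  proof -
    have "\<exists>k. action (ram forest_program) (run k (1, R', M')) = Answer (acyclic_from B D' vs) \<and>
      k \<le> 31 * length vs + 11 * card (snd ` I) * card (fst ` set vs - {i'}) + 1"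
      by (rule Cons.IH[of "us @ [e]" i' cs'])
        (use Cons.prems e inv' 3(3) M' M3 R' R3_12 in auto)
    then obtain k where k: "action (ram forest_program) (run k (1, R', M')) = Answer (acyclic_from B D' vs)"
      "k \<le> 31 * length vs + 11 * c * card (fst ` set vs - {i'}) + 1" by (auto simp: c_def)
    have "run (7 + k2 + k3 + k4 + k) (1, R, M) = run k (1, R', M')"
      by (simp only: run_add[of _ k] run_add[of _ k4] run3 run')
    then show ?thesis
      using k budget k4 acyc by (intro exI[of _ "7 + k2 + k3 + k4 + k"]) (simp add: c_def)
  qed
  show ?case
  proof (cases "B e = 0")
    case True
    then show ?thesis
      using next_entry[of 1 R3 M3 D] run_no_edge[of R3 M3] R3_7 e 3(2) by simp
  next
    case False
    then have R7: "R3 7 \<noteq> 0" using R3_7 e by simp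
    show ?thesis
    proof (cases "closes_cycle D (i', j)")
      case True
      from run_edge(1)[OF 3(2) ptr_j 3(4) R7 True] obtain R' where
        R': "run 5 (36, R3, M3) = (44, R', M3)" by blast
      have "run (7 + k2 + k3 + 5) (1, R, M) = (44, R', M3)"
        by (simp only: run_add[of _ 5] run3 R')
      then show ?thesis
        using True False e budget
        by (intro exI[of _ "7 + k2 + k3 + 5"])
          (simp add: ram_def ram_action_def forest_program_def c_def)
    next
      case acyclic: False
      from run_edge(2)[OF 3(2) ptr_j 3(4) R7 acyclic] obtain R' M' where
        "run 8 (36, R3, M3) = (1, R', M')" "invariant cs' i' (insert (i', j) D) R' M'"
        "\<forall>a\<ge>0. M' a = M3 a" "\<forall>r\<in>{1, 2}. R' r = R3 r" by blast
      then show ?thesis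
        using next_entry[of 8 R' M' "insert (i', j) D"] acyclic False e by simp
    qed
  qed
qed

text \<open>Row 0, which does not meet the grid, serves as the row before the first; with no column
  seen, the initial memory satisfies the invariant.\<close>

lemma forest_program_run:
  assumes "I \<subseteq> grid n"
  shows "\<exists>k. answer_at (ram forest_program) n I B k = Some (acyclic_from B {} (row_major I)) \<and>
    k \<le> 31 * card I + 11 * card (snd ` I) * card (fst ` I) + 2"
proof -
  have finite_I: "finite I" using finite_subset[OF assms] by (simp add: grid_def)
  define R :: "nat \<Rightarrow> int" where "R = (\<lambda>_. 0)(0 := int n, 1 := int (card I), 3 := 1)"
  define M where "M = snd (snd (ram_start n I))"
  have start: "run 1 (ram_start n I) = (1, R, M)"
    by (simp add: run_simps ram_start_def R_def M_def)
  have neg: "M a = 0" if "a < 0" for a using that by (simp add: M_def ram_start_def)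
  have "M (ptr j) = 0 \<and> M (ptr j + 1) = 0" if "j > 0" for j
    using that by (auto simp: ptr_def intro!: neg)
  moreover have "label [] M = ptr" by (simp add: label_def fun_eq_iff)
  moreover have "inj ptr" by (auto intro: injI)
  ultimately have inv: "invariant [] 0 {} R M"
    using represents_empty[of ptr 0] by (simp add: invariant_def marked_def R_def)
  have "\<exists>k. action (ram forest_program) (run k (1, R, M)) = Answer (acyclic_from B {} (row_major I)) \<and>
    k \<le> 31 * length (row_major I) + 11 * card (snd ` I) * card (fst ` set (row_major I) - {0}) + 1"
    by (rule run_forest_program[of "[]" _ 0 n "[]"])
      (use sorted_row_major assms inv in \<open>auto simp: length_row_major[OF finite_I] R_def M_def\<close>)
  then obtain k where k:
    "action (ram forest_program) (run k (1, R, M)) = Answer (acyclic_from B {} (row_major I))"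
    "k \<le> 31 * card I + 11 * card (snd ` I) * card (fst ` I - {0}) + 1"
    by (auto simp: length_row_major[OF finite_I] set_row_major[OF finite_I])
  have "card (fst ` I - {0}) \<le> card (fst ` I)" by (rule card_mono) (use finite_I in auto)
  then have "11 * card (snd ` I) * card (fst ` I - {0}) \<le> 11 * card (snd ` I) * card (fst ` I)" by simp
  then have "1 + k \<le> 31 * card I + 11 * card (snd ` I) * card (fst ` I) + 2" using k(2) by linarith
  moreover have "state_at (ram forest_program) n I B (1 + k) = run k (1, R, M)"
    using start run_add[of 1 k "ram_start n I"] by (simp add: state_at_def run_def ram_def)
  ultimately show ?thesis using k(1)
    by (intro exI[of _ "1 + k"]) (simp add: answer_at_def)
qed

end


section \<open>Running times\<close>

lemma finite_subset_grid: "I \<subseteq> grid n \<Longrightarrow> finite I"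
  by (rule finite_subset[of _ "grid n"]) (simp_all add: grid_def)

lemma zero_signs_finite_nonempty:
  assumes "finite I"
  shows "finite (zero_signs I)" "zero_signs I \<noteq> {}"
  unfolding zero_signs_def using assms by (auto simp: PiE_eq_empty_iff intro!: finite_PiE)

text \<open>The forest criterion does not mention \<open>J\<close>, so one answer is right for all
  \<open>J\<close> containing \<open>I\<close>.\<close>

lemma decides_forest_program: "decides_chio_eq_lcf (ram forest_program)"
  unfolding decides_chio_eq_lcf_def
proof (intro allI impI ballI)
  fix n I J B assume *: "I \<subseteq> J" "J \<subseteq> grid n" "B \<in> zero_signs I"
  then have I: "I \<subseteq> grid n" by blast
  interpret chio_instance n I J B using * by unfold_locales
  show "\<exists>t. answer_at (ram forest_program) n I B t =
      Some (P_chio n J (entry_event I J B) = P_lcf J (entry_event I J B))"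
    using forest_program_run[OF I, of B]
      chio_eq_lcf_iff_acyclic[OF distinct_row_major set_row_major[OF finite_I]] by auto
qed

lemma run_time_le:
  "answer_at A n I B t \<noteq> None \<Longrightarrow> run_time A n I B \<le> t"
  unfolding run_time_def by (rule Least_le)

text \<open>44 = 31 + 11 + 2: \<open>I\<close> lies in the product of its projections, and that
  product is nonempty, which absorbs the additive 2.\<close>

lemma worst_time_forest_program:
  assumes "I \<subseteq> grid n" "I \<noteq> {}"
  shows "worst_time (ram forest_program) n I \<le> 44 * (card (fst ` I) * card (snd ` I))"
proof -
  have I: "finite I" by (rule finite_subset_grid[OF assms(1)])
  define c where "c = card (fst ` I) * card (snd ` I)"
  have "card I \<le> card (fst ` I \<times> snd ` I)"
    by (rule card_mono) (use I in \<open>auto intro: rev_image_eqI\<close>)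
  then have "card I \<le> c" by (simp add: card_cartesian_product c_def)
  moreover have "c > 0" using I assms(2) by (simp add: card_gt_0_iff c_def)
  moreover have "11 * card (snd ` I) * card (fst ` I) = 11 * c" by (simp add: c_def)
  ultimately have bound: "31 * card I + 11 * card (snd ` I) * card (fst ` I) + 2
      \<le> 44 * (card (fst ` I) * card (snd ` I))"
    unfolding c_def[symmetric] by linarith
  have "run_time (ram forest_program) n I B \<le> 44 * (card (fst ` I) * card (snd ` I))" for B
  proof -
    obtain k where "answer_at (ram forest_program) n I B k \<noteq> None"
      "k \<le> 31 * card I + 11 * card (snd ` I) * card (fst ` I) + 2"
      using forest_program_run[OF assms(1), of B] by auto
    then show ?thesis using run_time_le bound by (meson order_trans)
  qed
  then show ?thesis
    unfolding worst_time_def using zero_signs_finite_nonempty[OF I] by (subst Max_le_iff) auto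
qed

lemma eventually_growing:
  assumes "growing_index_sets I"
  shows "eventually (\<lambda>n. I n \<subseteq> grid n \<and> I n \<noteq> {}) at_top"
proof -
  have "eventually (\<lambda>n. card (I n) \<ge> 1) at_top"
    using assms unfolding growing_index_sets_def filterlim_at_top by blast
  then show ?thesis
    using eventually_ge_at_top[of 2]
    by eventually_elim (use assms in \<open>auto simp: growing_index_sets_def\<close>)
qed

lemma card_projections_le:
  assumes "I \<subseteq> grid n"
  shows "card (fst ` I) * card (snd ` I) \<le> n ^ 2"
proof -
  have "card (fst ` I) \<le> card {1..n - 1}" "card (snd ` I) \<le> card {1..n - 1}"
    by (rule card_mono; use assms in \<open>force simp: grid_def\<close>)+
  then have "card (fst ` I) \<le> n" "card (snd ` I) \<le> n" by auto
  then show ?thesis by (simp add: power2_eq_square mult_le_mono)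
qed

section \<open>Lower bound by counting queries\<close>

lemma state_at_Suc: "state_at A n I B (Suc t) = step A I B (state_at A n I B t)"
  by (simp add: state_at_def)

lemma answer_at_eq_Some_iff:
  "answer_at A n I B t = Some b \<longleftrightarrow> action A (state_at A n I B t) = Answer b"
  by (simp add: answer_at_def split: action.split)

lemma answer_at_mono:
  assumes "answer_at A n I B t = Some b" "t \<le> t'"
  shows "answer_at A n I B t' = Some b"
  using assms(2,1)
proof (induction rule: dec_induct)
  case (step t')
  then have "state_at A n I B (Suc t') = state_at A n I B t'"
    by (simp add: state_at_Suc answer_at_eq_Some_iff step_def)
  then show ?case using step by (simp add: answer_at_def)
qed

lemma answer_at_unique:
  assumes "answer_at A n I B t = Some b" "answer_at A n I B t' = Some b'"
  shows "b = b'"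
  using answer_at_mono[OF assms(1), of "max t t'"] answer_at_mono[OF assms(2), of "max t t'"] by simp

definition queried :: "'s algorithm \<Rightarrow> nat \<Rightarrow> index set \<Rightarrow> (index \<Rightarrow> int) \<Rightarrow> nat \<Rightarrow> index set" where
  "queried A n I B T = {p. \<exists>t<T. \<exists>f. action A (state_at A n I B t) = Query p f}"

lemma card_queried: "finite (queried A n I B T)" "card (queried A n I B T) \<le> T"
proof -
  let ?q = "\<lambda>t. case action A (state_at A n I B t) of Query p f \<Rightarrow> p | _ \<Rightarrow> undefined"
  have *: "queried A n I B T \<subseteq> ?q ` {..<T}"
    unfolding queried_def by (force simp: image_iff)
  then show "finite (queried A n I B T)" by (rule finite_subset) simp
  have "card (queried A n I B T) \<le> card (?q ` {..<T})" by (rule card_mono) (use * in auto)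
  also have "\<dots> \<le> T" using card_image_le[of "{..<T}" ?q] by simp
  finally show "card (queried A n I B T) \<le> T" .
qed

text \<open>The matrix enters a run only through replies, so a change at a position never asked for
  goes unnoticed.\<close>

lemma state_at_unqueried:
  assumes "p \<notin> queried A n I B T" "t \<le> T"
  shows "state_at A n I (B(p := b)) t = state_at A n I B t"
  using assms(2)
proof (induction t)
  case 0
  then show ?case by (simp add: state_at_def)
next
  case (Suc t)
  then have "\<nexists>f. action A (state_at A n I B t) = Query p f"
    using assms(1) by (auto simp: queried_def)
  then show ?case
    using Suc by (auto simp: state_at_Suc step_def split: action.split)
qed

definition star :: "index set \<Rightarrow> index \<Rightarrow> int" where
  "star I = restrict (\<lambda>(i, j). if i = 1 \<or> j = 1 then 1 else 0) I"

lemma star_in_zero_signs: "star I \<in> zero_signs I"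
  by (auto simp: star_def zero_signs_def split: if_splits)

lemma chio_eq_lcf_star:
  "P_chio n (grid n) (entry_event (grid n) (grid n) (star (grid n))) =
    P_lcf (grid n) (entry_event (grid n) (grid n) (star (grid n)))"
proof -
  interpret chio_instance n "grid n" "grid n" "star (grid n)"
    using star_in_zero_signs by unfold_locales auto
  show ?thesis
  proof (rule chio_eq_lcfI)
    fix p assume p: "p \<in> grid n" "star (grid n) p \<noteq> 0"
    obtain i j where ij: "p = (i, j)" by (cases p)
    have tree: "q \<in> grid n \<Longrightarrow> star (grid n) q \<noteq> 0 \<longleftrightarrow> fst q = 1 \<or> snd q = 1" for q
      by (auto simp: star_def split: prod.splits)
    \<comment> \<open>The colours are the two sides left when \<open>p\<close> is removed from the
      tree: column \<open>j\<close> alone if \<open>j\<close> is not 1, row \<open>i\<close> alone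
      if \<open>j = 1\<close> and \<open>i\<close> is not 1, and for \<open>(1, 1)\<close> row 1
      together with all columns but the first.\<close>
    define x where "x k \<longleftrightarrow> (if j = 1 then k = i else True)" for k :: nat
    define y where "y l \<longleftrightarrow> (if j = 1 then i = 1 \<and> l \<noteq> 1 else l \<noteq> j)" for l :: nat
    have "x k = y l" if "(k, l) \<in> grid n" "star (grid n) (k, l) \<noteq> 0" "(k, l) \<noteq> p" for k l
    proof -
      have "i = 1 \<or> j = 1" "k = 1 \<or> l = 1"
        using tree[OF p(1)] tree[OF that(1)] p(2) that(2) by (simp_all add: ij)
      then show ?thesis using that(3) unfolding ij x_def y_def by (cases "j = 1") auto
    qed
    then have "\<forall>(k, l)\<in>{q \<in> grid n. star (grid n) q \<noteq> 0 \<and> q \<noteq> p}. x k = y l" by auto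
    moreover have "x (fst p) \<noteq> y (snd p)" by (simp add: x_def y_def ij)
    ultimately show "\<not> closes_cycle {q \<in> grid n. star (grid n) q \<noteq> 0 \<and> q \<noteq> p} p"
      unfolding closes_cycle_def by blast
  qed
qed

lemma chio_neq_lcf_star_update:
  assumes "p \<in> {2..n - 1} \<times> {2..n - 1}"
  shows "(star (grid n))(p := 1) \<in> zero_signs (grid n)"
    and "P_chio n (grid n) (entry_event (grid n) (grid n) ((star (grid n))(p := 1))) \<noteq>
      P_lcf (grid n) (entry_event (grid n) (grid n) ((star (grid n))(p := 1)))"
proof -
  obtain i j where ij: "p = (i, j)" "i \<ge> 2" "j \<ge> 2" "i \<le> n - 1" "j \<le> n - 1"
    using assms by (cases p) auto
  then have grid: "(i, j) \<in> grid n" "(1, j) \<in> grid n" "(i, 1) \<in> grid n" "(1, 1) \<in> grid n"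
    by (auto simp: grid_def)
  let ?B = "(star (grid n))(p := 1)"
  show B: "?B \<in> zero_signs (grid n)"
    using star_in_zero_signs[of "grid n"] grid(1) ij(1)
    by (auto simp: zero_signs_def PiE_def Pi_def extensional_def)
  interpret chio_instance n "grid n" "grid n" ?B
    using B by unfold_locales auto
  \<comment> \<open>The path from row \<open>i\<close> through column 1 and row 1 to column
    \<open>j\<close>, which \<open>p\<close> closes to a 4-cycle.\<close>
  have path: "{(1, 1), (1, j), (i, 1)} \<subseteq> {q \<in> grid n. ?B q \<noteq> 0 \<and> q \<noteq> p}"
    using grid ij by (auto simp: star_def)
  have "closes_cycle {(1, 1), (1, j), (i, 1)} p"
    by (auto simp: closes_cycle_def ij(1))
  then have "closes_cycle {q \<in> grid n. ?B q \<noteq> 0 \<and> q \<noteq> p} p"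
    using path by (rule closes_cycle_mono)
  then show "P_chio n (grid n) (entry_event (grid n) (grid n) ?B) \<noteq>
      P_lcf (grid n) (entry_event (grid n) (grid n) ?B)"
    using grid(1) ij(1) by (intro chio_neq_lcfI[of p]) auto
qed

lemma worst_time_ge:
  assumes A: "decides_chio_eq_lcf A" and n: "n \<ge> 2"
  shows "worst_time A n (grid n) \<ge> (n - 2) ^ 2"
proof -
  let ?I = "grid n" and ?B = "star (grid n)"
  define T where "T = run_time A n ?I ?B"
  have decides: "\<exists>t. answer_at A n ?I B t =
      Some (P_chio n ?I (entry_event ?I ?I B) = P_lcf ?I (entry_event ?I ?I B))"
    if "B \<in> zero_signs ?I" for B
    using A n that unfolding decides_chio_eq_lcf_def by blast
  obtain t where t: "answer_at A n ?I ?B t = Some True"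
    using decides[OF star_in_zero_signs] chio_eq_lcf_star by auto
  then have "answer_at A n ?I ?B T \<noteq> None"
    unfolding T_def run_time_def by (intro LeastI[of "\<lambda>t. answer_at A n ?I ?B t \<noteq> None" t]) simp
  then have T: "answer_at A n ?I ?B T = Some True"
    using answer_at_unique[OF t] by fastforce
  have "{2..n - 1} \<times> {2..n - 1} \<subseteq> queried A n ?I ?B T"
  proof
    fix p assume p: "p \<in> {2..n - 1} \<times> {2..n - 1}"
    show "p \<in> queried A n ?I ?B T"
    proof (rule ccontr)
      assume "p \<notin> queried A n ?I ?B T"
      then have "answer_at A n ?I (?B(p := 1)) T = Some True"
        using T state_at_unqueried[of p A n ?I ?B T T 1] by (simp add: answer_at_def)
      moreover obtain t' where "answer_at A n ?I (?B(p := 1)) t' = Some False"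
        using decides[OF chio_neq_lcf_star_update(1)[OF p]] chio_neq_lcf_star_update(2)[OF p] by auto
      ultimately show False using answer_at_unique by blast
    qed
  qed
  then have "card ({2..n - 1} \<times> {2..n - 1}) \<le> card (queried A n ?I ?B T)"
    by (intro card_mono card_queried)
  also have "\<dots> \<le> T" by (rule card_queried)
  also have "T \<le> worst_time A n ?I"
    unfolding worst_time_def T_def
    using zero_signs_finite_nonempty[OF finite_subset_grid[OF order_refl]] star_in_zero_signs
    by (intro Max_ge) auto
  finally show ?thesis by (simp add: card_cartesian_product power2_eq_square numeral_2_eq_2)
qed

lemma projections_grid: "fst ` grid n = {1..n - 1}" "snd ` grid n = {1..n - 1}"
  by (force simp: grid_def)+

lemma growing_grid: "growing_index_sets grid"
proof -
  have "filterlim (\<lambda>n::nat. n - 1) at_top at_top" by (rule filterlim_minus_const_nat_at_top)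
  moreover have "n - 1 \<le> card (grid n)" for n by (auto simp: grid_def card_cartesian_product)
  then have "eventually (\<lambda>n. n - 1 \<le> card (grid n)) at_top" by (intro always_eventually allI)
  ultimately have "filterlim (\<lambda>n. card (grid n)) at_top at_top"
    by (rule filterlim_at_top_mono)
  then show ?thesis by (simp add: growing_index_sets_def)
qed

theorem corollary36:
  shows "(\<exists>P. decides_chio_eq_lcf (ram P) \<and>
            (\<forall>I. growing_index_sets I \<longrightarrow>
               (\<lambda>n. real (worst_time (ram P) n (I n)))
                  \<in> O(\<lambda>n. real (card (fst ` I n) * card (snd ` I n))) \<and>
               O(\<lambda>n. real (card (fst ` I n) * card (snd ` I n)))
                  \<subseteq> O(\<lambda>n. real (n ^ 2))))
       \<and> \<not> (\<exists>A :: 's algorithm. decides_chio_eq_lcf A \<and>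
            (\<forall>I. growing_index_sets I \<longrightarrow>
               (\<lambda>n. real (worst_time A n (I n)))
                  \<in> o(\<lambda>n. real (card (fst ` I n) * card (snd ` I n)))))"
proof (intro conjI notI)
  show "\<exists>P. decides_chio_eq_lcf (ram P) \<and>
            (\<forall>I. growing_index_sets I \<longrightarrow>
               (\<lambda>n. real (worst_time (ram P) n (I n)))
                  \<in> O(\<lambda>n. real (card (fst ` I n) * card (snd ` I n))) \<and>
               O(\<lambda>n. real (card (fst ` I n) * card (snd ` I n)))
                  \<subseteq> O(\<lambda>n. real (n ^ 2)))"
  proof (intro exI[of _ forest_program] conjI allI impI decides_forest_program)
    fix I assume I: "growing_index_sets I"
    show "(\<lambda>n. real (worst_time (ram forest_program) n (I n)))
        \<in> O(\<lambda>n. real (card (fst ` I n) * card (snd ` I n)))"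
    proof (rule bigoI[of _ 44])
      show "eventually (\<lambda>n. norm (real (worst_time (ram forest_program) n (I n)))
          \<le> 44 * norm (real (card (fst ` I n) * card (snd ` I n)))) at_top"
        using eventually_growing[OF I]
      proof eventually_elim
        case (elim n)
        then have "real (worst_time (ram forest_program) n (I n))
            \<le> real (44 * (card (fst ` I n) * card (snd ` I n)))"
          by (intro of_nat_mono worst_time_forest_program) auto
        then show ?case by simp
      qed
    qed
    have "(\<lambda>n. real (card (fst ` I n) * card (snd ` I n))) \<in> O(\<lambda>n. real (n ^ 2))"
    proof (rule bigoI[of _ 1])
      show "eventually (\<lambda>n. norm (real (card (fst ` I n) * card (snd ` I n)))
          \<le> 1 * norm (real (n ^ 2))) at_top"
        using eventually_growing[OF I]
      proof eventually_elim
        case (elim n)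
        then have "real (card (fst ` I n) * card (snd ` I n)) \<le> real (n ^ 2)"
          by (intro of_nat_mono card_projections_le) auto
        then show ?case by simp
      qed
    qed
    then show "O(\<lambda>n. real (card (fst ` I n) * card (snd ` I n))) \<subseteq> O(\<lambda>n. real (n ^ 2))"
      by (auto intro: landau_o.big_trans)
  qed
next
  assume "\<exists>A :: 's algorithm. decides_chio_eq_lcf A \<and>
            (\<forall>I. growing_index_sets I \<longrightarrow>
               (\<lambda>n. real (worst_time A n (I n)))
                  \<in> o(\<lambda>n. real (card (fst ` I n) * card (snd ` I n))))"
  then obtain A :: "'s algorithm" where A: "decides_chio_eq_lcf A"
    and "(\<lambda>n. real (worst_time A n (grid n)))
        \<in> o(\<lambda>n. real (card (fst ` grid n) * card (snd ` grid n)))"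
    using growing_grid by blast
  \<comment> \<open>With \<open>m = n - 2\<close>, the constant 1/5 turns the two bounds into
    \<open>5 * m ^ 2 \<le> (m + 1) ^ 2\<close>. This fails for \<open>m \<ge> 1\<close>, since the
    right side is at most \<open>4 * m ^ 2\<close>.\<close>
  then have "eventually (\<lambda>n. norm (real (worst_time A n (grid n))) \<le>
      1 / 5 * norm (real (card (fst ` grid n) * card (snd ` grid n)))) at_top"
    by (intro landau_o.smallD) auto
  then have "eventually (\<lambda>n. 5 * worst_time A n (grid n) \<le> (n - 1) ^ 2) at_top"
  proof eventually_elim
    case (elim n)
    then have "real (5 * worst_time A n (grid n)) \<le> real ((n - 1) ^ 2)"
      by (simp add: projections_grid power2_eq_square)
    then show ?case by (simp only: of_nat_le_iff)
  qed
  then have "eventually (\<lambda>n. 5 * worst_time A n (grid n) \<le> (n - 1) ^ 2 \<and> n \<ge> 3) at_top"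
    using eventually_ge_at_top[of 3] by eventually_elim simp
  then obtain n where n: "5 * worst_time A n (grid n) \<le> (n - 1) ^ 2" "n \<ge> 3"
    by (auto simp: eventually_at_top_linorder)
  define m where "m = n - 2"
  have "5 * m ^ 2 \<le> (m + 1) ^ 2" "m \<ge> 1"
    using n worst_time_ge[OF A, of n] by (simp_all add: m_def Suc_diff_Suc numeral_2_eq_2)
  moreover have "m \<le> m ^ 2" "1 \<le> m ^ 2" using \<open>m \<ge> 1\<close> by (simp_all add: power2_eq_square)
  moreover have "(m + 1) ^ 2 = m ^ 2 + 2 * m + 1" by (simp add: power2_eq_square)
  ultimately show False by linarith
qed

end
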